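(* Let $n,m\ge1$ be integers, $0<\alpha<nm$ and $\delta>0$. There is a constant $C>0$ such that for every weight $u$ on $\mathbb{R}^n$ and every $\vec f=(f_1,\dots,f_m)$, $$\|\mathcal{I}_\alpha\vec f\|_{L^{1/m,\infty}(u)}\le C\,\|\mathcal{M}_\alpha\vec f\|_{L^{1/m,\infty}(M_{L(\log L)^\delta}(u))}.$$
   Context: A weight is a nonnegative measurable function on $\mathbb{R}^n$. Cubes have sides parallel to the axes. The multilinear fractional integral is $\mathcal{I}_\alpha\vec f(x)=\int_{(\mathbb{R}^n)^m}\frac{f_1(y_1)\cdots f_m(y_m)}{(|x-y_1|+\dots+|x-y_m|)^{mn-\alpha}}\,d\vec y$, for functions $f_i$ for which the integral converges (for instance Schwartz functions). The multilinear fractional maximal operator is $\mathcal{M}_\alpha\vec f(x)=\sup_{Q\ni x}|Q|^{\alpha/n}\prod_{i=1}^m\frac1{|Q|}\int_Q|f_i|$. $M_{L(\log L)^\delta}f(x)=\sup_{Q\ni x}\|f\|_{B,Q}$ with $B(t)=t(1+\log^+t)^\delta$ and $\|f\|_{B,Q}=\inf\{\lambda>0:\frac1{|Q|}\int_Q B(|f|/\lambda)\le1\}$. Suprema are over all cubes $Q$ containing $x$. $\|F\|_{L^{r,\infty}(v)}=\sup_{\lambda>0}\lambda\,v(\{|F|>\lambda\})^{1/r}$, with $v(E)=\int_E v$. *)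

theory Defs
  imports "HOL-Analysis.Analysis"
begin

definition weight :: "(real^'n \<Rightarrow> real) \<Rightarrow> bool" where
  "weight u \<longleftrightarrow> u \<in> borel_measurable lebesgue \<and> (\<forall>x. 0 \<le> u x)"

text \<open>Cubes are closed and of positive side length.\<close>

definition cube :: "(real^'n) set \<Rightarrow> bool" where
  "cube Q \<longleftrightarrow> (\<exists>a l. 0 < l \<and> Q = cbox a (\<chi> i. a $ i + l))"

text \<open>The average of a \<open>[0,\<infinity>]\<close>-valued function; it is \<open>\<infinity>\<close> if the function is not
  integrable over \<open>Q\<close>.\<close>

definition average :: "(real^'n) set \<Rightarrow> (real^'n \<Rightarrow> ennreal) \<Rightarrow> ennreal" where
  "average Q g = (\<integral>\<^sup>+ y \<in> Q. g y \<partial>lebesgue) / emeasure lebesgue Q"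

text \<open>In the functions below the tuple \<open>(f\<^sub>1, \<dots>, f\<^sub>m)\<close> is given by \<open>f 0, \<dots>, f (m - 1)\<close>, and a point
  of the \<open>m\<close>-fold product of \<open>\<real>\<^sup>n\<close> is an element of the space of \<open>\<Pi>\<^sub>M i\<in>{..<m}. lebesgue\<close>.\<close>

definition frac_integrand ::
    "real \<Rightarrow> nat \<Rightarrow> (nat \<Rightarrow> real^'n \<Rightarrow> complex) \<Rightarrow> real^'n \<Rightarrow> (nat \<Rightarrow> real^'n) \<Rightarrow> complex" where
  "frac_integrand \<alpha> m f x y =
     (\<Prod>i<m. f i (y i)) /
       complex_of_real ((\<Sum>i<m. norm (x - y i)) powr (real m * real CARD('n) - \<alpha>))"

text \<open>The Bochner integral below is \<open>0\<close> by convention at points \<open>x\<close> where the integrand is not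
  integrable, so statements about \<open>frac_integral\<close> must assume \<open>frac_integral_converges\<close>.\<close>

definition frac_integral ::
    "real \<Rightarrow> nat \<Rightarrow> (nat \<Rightarrow> real^'n \<Rightarrow> complex) \<Rightarrow> real^'n \<Rightarrow> complex" where
  "frac_integral \<alpha> m f x = (\<integral>y. frac_integrand \<alpha> m f x y \<partial>(\<Pi>\<^sub>M i\<in>{..<m}. lebesgue))"

definition frac_integral_converges ::
    "real \<Rightarrow> nat \<Rightarrow> (nat \<Rightarrow> real^'n \<Rightarrow> complex) \<Rightarrow> bool" where
  "frac_integral_converges \<alpha> m f \<longleftrightarrow>
     (AE x in lebesgue. integrable (\<Pi>\<^sub>M i\<in>{..<m}. lebesgue) (frac_integrand \<alpha> m f x))"

definition frac_maximal ::
    "real \<Rightarrow> nat \<Rightarrow> (nat \<Rightarrow> real^'n \<Rightarrow> complex) \<Rightarrow> real^'n \<Rightarrow> ennreal" where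
  "frac_maximal \<alpha> m f x =
     (SUP Q \<in> {Q. cube Q \<and> x \<in> Q}.
        ennreal (measure lebesgue Q powr (\<alpha> / real CARD('n))) *
        (\<Prod>i<m. average Q (\<lambda>y. ennreal (norm (f i y)))))"

definition log_plus :: "real \<Rightarrow> real" where
  "log_plus t = max 0 (ln t)"

definition LlogL :: "real \<Rightarrow> real \<Rightarrow> real" where
  "LlogL \<delta> t = t * (1 + log_plus t) powr \<delta>"

text \<open>The Luxemburg norm is \<open>\<infinity>\<close> (the infimum of the empty set) if no \<open>\<lambda>\<close> is admissible.\<close>

definition orlicz_average :: "(real \<Rightarrow> real) \<Rightarrow> (real^'n) set \<Rightarrow> (real^'n \<Rightarrow> real) \<Rightarrow> ennreal" where
  "orlicz_average B Q f =
     (INF l \<in> {l::real. 0 < l \<and> average Q (\<lambda>y. ennreal (B (\<bar>f y\<bar> / l))) \<le> 1}. ennreal l)"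

definition orlicz_maximal :: "(real \<Rightarrow> real) \<Rightarrow> (real^'n \<Rightarrow> real) \<Rightarrow> real^'n \<Rightarrow> ennreal" where
  "orlicz_maximal B f x = (SUP Q \<in> {Q. cube Q \<and> x \<in> Q}. orlicz_average B Q f)"

text \<open>Powers with positive exponent on \<open>[0,\<infinity>]\<close>.\<close>

definition ennreal_powr :: "ennreal \<Rightarrow> real \<Rightarrow> ennreal" where
  "ennreal_powr a p = (if a = \<infinity> then \<infinity> else ennreal (enn2real a powr p))"

definition weighted_measure :: "(real^'n \<Rightarrow> ennreal) \<Rightarrow> (real^'n) set \<Rightarrow> ennreal" where
  "weighted_measure v E = (\<integral>\<^sup>+ x \<in> E. v x \<partial>lebesgue)"

text \<open>The \<open>L\<^sup>r\<^sup>,\<^sup>\<infinity>(v)\<close> quasinorm of a function with absolute value \<open>F\<close>.\<close>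

definition weak_norm :: "real \<Rightarrow> (real^'n \<Rightarrow> ennreal) \<Rightarrow> (real^'n \<Rightarrow> ennreal) \<Rightarrow> ennreal" where
  "weak_norm r v F =
     (SUP t \<in> {t::real. 0 < t}.
        ennreal t * ennreal_powr (weighted_measure v {x. F x > ennreal t}) (1 / r))"

end

theory Submission
  imports Defs
begin

text \<open>
  Fix a \<open>b\<close>-adic grid with a large base \<open>b\<close>. The fractional integral at \<open>x\<close> is dominated by the sum
  over \<open>k\<close> of \<open>a k x\<close>, the fractional average over the triple of the cell of side \<open>b powr k\<close> around \<open>x\<close>,
  and each \<open>a k x\<close> is dominated by the fractional maximal function. For fixed \<open>t\<close> the cells with
  \<open>t < a k x \<le> 2 t\<close> automatically form a sparse family, since \<open>\<alpha> > 0\<close> forces the averages to grow when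
  such cells are nested. Hence the number \<open>h x\<close> of these cells containing \<open>x\<close> is exponentially
  integrable on every cell, and \<open>u{h > s}\<close> is at most a constant times \<open>s powr (-1 - \<delta>) * v{M > c t}\<close>,
  where \<open>M\<close> is the fractional maximal function, \<open>v\<close> the Orlicz maximal function of \<open>u\<close>, and \<open>c\<close> a
  constant: one factor \<open>1 / s\<close> comes from sparseness, the factor \<open>s powr (-\<delta>)\<close> from the logarithm.
  For the level set of the fractional integral at height \<open>T\<close> take \<open>t = c' T / 2 ^ j\<close> and allow
  \<open>s = 2 powr (j * \<sigma>)\<close> overlaps. The choice \<open>\<sigma> < 1\<close> keeps the sum of the allowed contributions below
  \<open>T\<close>, and \<open>\<sigma> * (1 + \<delta>) > 1\<close> makes the weights of the exceptional sets summable.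
\<close>

section \<open>Sigma-finiteness and the volume of boxes\<close>

lemma sigma_finite_lebesgue:
  "sigma_finite_measure (lebesgue :: 'a::euclidean_space measure)"
proof
  obtain A :: "'a set set" where A: "countable A" "A \<subseteq> sets lborel" "\<Union>A = space lborel"
      "\<forall>a\<in>A. emeasure lborel a \<noteq> \<infinity>"
    using lborel.sigma_finite_countable by blast
  show "\<exists>A. countable A \<and> A \<subseteq> sets (lebesgue :: 'a measure) \<and> \<Union>A = space lebesgue \<and>
      (\<forall>a\<in>A. emeasure lebesgue a \<noteq> \<infinity>)"
    using A by (intro exI[of _ A]) (auto simp: subset_iff)
qed

text \<open>Makes Tonelli's theorem and finite product measures available over
  \<open>lebesgue\<close>, the measure with respect to which all functions here are
  measurable.\<close>

interpretation lebesgue: sigma_finite_measure "lebesgue :: 'a::euclidean_space measure"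
  by (rule sigma_finite_lebesgue)

lemma prod_inner_Basis_vec:
  fixes f :: "real^'n"
  shows "(\<Prod>i\<in>Basis. f \<bullet> i) = (\<Prod>i\<in>UNIV. f $ i)"
proof -
  have inj: "inj (\<lambda>i::'n. axis i (1::real))"
    by (auto simp: inj_on_def axis_eq_axis)
  have "(Basis :: (real^'n) set) = range (\<lambda>i. axis i 1)"
    by (auto simp: Basis_vec_def)
  then have "(\<Prod>i\<in>Basis. f \<bullet> i) = (\<Prod>i\<in>range (\<lambda>i. axis i 1). f \<bullet> i)"
    by (simp only:)
  also have "\<dots> = (\<Prod>i\<in>UNIV. f $ i)"
    using prod.reindex[OF inj, of "\<lambda>i. f \<bullet> i"] by (simp add: inner_axis)
  finally show ?thesis .
qed

text \<open>The half-open cells and their triples below lie between an open and a closed box of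
  equal volume, so one sandwich gives the volume of all of them.\<close>

lemma emeasure_between_boxes:
  fixes a :: "real^'n"
  assumes "0 \<le> l" "box a (\<chi> i. a $ i + l) \<subseteq> S" "S \<subseteq> cbox a (\<chi> i. a $ i + l)"
    "S \<in> sets lebesgue"
  shows "emeasure lebesgue S = ennreal (l ^ CARD('n))"
proof (rule antisym)
  have B: "\<And>i. i \<in> Basis \<Longrightarrow> a \<bullet> i \<le> (\<chi> i. a $ i + l) \<bullet> i"
    using assms(1) by (auto simp: Basis_vec_def inner_axis)
  have P: "prod ((\<bullet>) ((\<chi> i. a $ i + l) - a)) Basis = l ^ CARD('n)"
    by (simp add: prod_inner_Basis_vec)
  have "emeasure lebesgue S \<le> emeasure lebesgue (cbox a (\<chi> i. a $ i + l))"
    by (intro emeasure_mono assms) auto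
  also have "\<dots> = ennreal (l ^ CARD('n))"
    using emeasure_lborel_cbox[of a "\<chi> i. a $ i + l"] B P by simp
  finally show "emeasure lebesgue S \<le> ennreal (l ^ CARD('n))" .
  have "ennreal (l ^ CARD('n)) = emeasure lebesgue (box a (\<chi> i. a $ i + l))"
    using emeasure_lborel_box[of a "\<chi> i. a $ i + l"] B P by simp
  also have "\<dots> \<le> emeasure lebesgue S"
    by (intro emeasure_mono assms)
  finally show "ennreal (l ^ CARD('n)) \<le> emeasure lebesgue S" .
qed

section \<open>The grid with integer base\<close>

definition side :: "nat \<Rightarrow> int \<Rightarrow> real" where
  "side b k = real b powr real_of_int k"

text \<open>A cell is encoded by an integer vector. Families of cells then become predicates on
  indices, and since there are countably many indices, every function of the index of
  \<open>x\<close> is measurable in \<open>x\<close>.\<close>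

definition grid_index :: "nat \<Rightarrow> int \<Rightarrow> real^'n \<Rightarrow> int^'n" where
  "grid_index b k x = (\<chi> i. \<lfloor>x $ i / side b k\<rfloor>)"

definition grid_cell :: "nat \<Rightarrow> int \<Rightarrow> int^'n \<Rightarrow> (real^'n) set" where
  "grid_cell b k z = {x. grid_index b k x = z}"

text \<open>The half-open triple of a cell. Phrasing it by indices makes the relation symmetric in
  the two points and reduces the nesting of triples to a fact about integer division.\<close>

definition grid_nbhd :: "nat \<Rightarrow> int \<Rightarrow> int^'n \<Rightarrow> (real^'n) set" where
  "grid_nbhd b k z = {x. \<forall>i. \<bar>grid_index b k x $ i - z $ i\<bar> \<le> 1}"

text \<open>The maximal operators range over closed cubes, whereas cells must be half-open to
  partition space; \<open>grid_cube\<close> and \<open>grid_cube3\<close> are the closed versions of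
  a cell and of its triple.\<close>

definition grid_cube :: "nat \<Rightarrow> int \<Rightarrow> int^'n \<Rightarrow> (real^'n) set" where
  "grid_cube b k z = cbox (\<chi> i. side b k * z $ i) (\<chi> i. side b k * z $ i + side b k)"

definition grid_cube3 :: "nat \<Rightarrow> int \<Rightarrow> int^'n \<Rightarrow> (real^'n) set" where
  "grid_cube3 b k z =
     cbox (\<chi> i. side b k * (z $ i - 1)) (\<chi> i. side b k * (z $ i - 1) + 3 * side b k)"

lemma mem_grid_cell [simp]: "x \<in> grid_cell b k z \<longleftrightarrow> grid_index b k x = z"
  by (simp add: grid_cell_def)

lemma side_pos: "0 < b \<Longrightarrow> 0 < side b k"
  by (simp add: side_def)

lemma side_add: "0 < b \<Longrightarrow> side b (j + k) = side b j * side b k"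
  by (simp add: side_def powr_add)

lemma measurable_grid_index [measurable]:
  "grid_index b k \<in> lebesgue \<rightarrow>\<^sub>M count_space UNIV"
proof (subst measurable_count_space_eq2_countable, safe)
  fix z :: "int^'n"
  have "grid_index b k -` {z} \<inter> space lebesgue =
      {x. \<forall>i. real_of_int (z $ i) \<le> x $ i / side b k \<and> x $ i / side b k < real_of_int (z $ i) + 1}"
    by (auto simp: grid_index_def vec_eq_iff floor_eq_iff)
  also have "\<dots> \<in> sets lborel" by measurable
  finally show "grid_index b k -` {z} \<inter> space lebesgue \<in> sets lebesgue" by simp
qed auto

lemma measurable_of_grid_index [measurable (raw)]:
  "(\<lambda>x. g (grid_index b k x)) \<in> lebesgue \<rightarrow>\<^sub>M N" if "range g \<subseteq> space N"
  using that by (intro measurable_compose[OF measurable_grid_index]) auto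

lemma sets_grid_index: "{x. P (grid_index b k x)} \<in> sets lebesgue"
proof -
  have "grid_index b k -` {z. P z} \<inter> space lebesgue \<in> sets lebesgue"
    by (rule measurable_sets[OF measurable_grid_index]) auto
  then show ?thesis by (simp add: vimage_def)
qed

lemma sets_grid_cell [measurable]: "grid_cell b k z \<in> sets lebesgue"
  unfolding grid_cell_def by (rule sets_grid_index)

lemma sets_grid_nbhd [measurable]: "grid_nbhd b k z \<in> sets lebesgue"
  unfolding grid_nbhd_def by (rule sets_grid_index)

lemma grid_index_nth_le_iff:
  "0 < b \<Longrightarrow> c \<le> grid_index b k x $ i \<longleftrightarrow> side b k * real_of_int c \<le> x $ i"
  using side_pos[of b k] by (simp add: grid_index_def le_floor_iff field_simps)

lemma mem_grid_cell_iff: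
  "0 < b \<Longrightarrow> x \<in> grid_cell b k z \<longleftrightarrow>
     (\<forall>i. side b k * z $ i \<le> x $ i \<and> x $ i < side b k * z $ i + side b k)"
proof -
  assume b: "0 < b"
  have "grid_index b k x $ i = z $ i \<longleftrightarrow>
      side b k * z $ i \<le> x $ i \<and> x $ i < side b k * z $ i + side b k" for i
    using grid_index_nth_le_iff[OF b, of "z $ i" k x i]
      grid_index_nth_le_iff[OF b, of "z $ i + 1" k x i]
    by (auto simp: algebra_simps)
  then show ?thesis by (simp add: vec_eq_iff)
qed

lemma mem_grid_nbhd_iff:
  "0 < b \<Longrightarrow> x \<in> grid_nbhd b k z \<longleftrightarrow>
     (\<forall>i. side b k * (z $ i - 1) \<le> x $ i \<and> x $ i < side b k * (z $ i - 1) + 3 * side b k)"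
proof -
  assume b: "0 < b"
  have "\<bar>grid_index b k x $ i - z $ i\<bar> \<le> 1 \<longleftrightarrow>
      side b k * (z $ i - 1) \<le> x $ i \<and> x $ i < side b k * (z $ i - 1) + 3 * side b k" for i
    using grid_index_nth_le_iff[OF b, of "z $ i - 1" k x i]
      grid_index_nth_le_iff[OF b, of "z $ i + 2" k x i]
    by (auto simp: algebra_simps)
  then show ?thesis by (simp add: grid_nbhd_def)
qed

lemma grid_cell_subset_cube: "0 < b \<Longrightarrow> grid_cell b k z \<subseteq> grid_cube b k z"
  by (auto simp: mem_grid_cell_iff grid_cube_def mem_box_cart less_imp_le simp del: mem_grid_cell)

lemma grid_nbhd_subset_cube3: "0 < b \<Longrightarrow> grid_nbhd b k z \<subseteq> grid_cube3 b k z"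
  by (auto simp: mem_grid_nbhd_iff grid_cube3_def mem_box_cart less_imp_le)

lemma cube_grid_cube: "0 < b \<Longrightarrow> cube (grid_cube b k z)"
  unfolding cube_def grid_cube_def using side_pos[of b k]
  by (intro exI[of _ "\<chi> i. side b k * z $ i"] exI[of _ "side b k"]) auto

lemma cube_grid_cube3: "0 < b \<Longrightarrow> cube (grid_cube3 b k z)"
  unfolding cube_def grid_cube3_def using side_pos[of b k]
  by (intro exI[of _ "\<chi> i. side b k * (z $ i - 1)"] exI[of _ "3 * side b k"]) auto

lemma emeasure_grid_cube:
  "0 < b \<Longrightarrow> emeasure lebesgue (grid_cube b k z :: (real^'n) set) = ennreal (side b k ^ CARD('n))"
  unfolding grid_cube_def using side_pos[of b k]
  by (intro emeasure_between_boxes[where a = "\<chi> i. side b k * z $ i"]) (auto simp: mem_box_cart less_imp_le)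

lemma emeasure_grid_cube3:
  "0 < b \<Longrightarrow>
    emeasure lebesgue (grid_cube3 b k z :: (real^'n) set) = ennreal ((3 * side b k) ^ CARD('n))"
  unfolding grid_cube3_def using side_pos[of b k]
  by (intro emeasure_between_boxes[where a = "\<chi> i. side b k * (z $ i - 1)"]) (auto simp: mem_box_cart less_imp_le)

lemma emeasure_grid_cell:
  "0 < b \<Longrightarrow> emeasure lebesgue (grid_cell b k z :: (real^'n) set) = ennreal (side b k ^ CARD('n))"
  using side_pos[of b k]
  by (intro emeasure_between_boxes[where a = "\<chi> i. side b k * z $ i"])
    (auto simp: mem_grid_cell_iff mem_box_cart less_imp_le simp del: mem_grid_cell)

lemma emeasure_grid_nbhd:
  "0 < b \<Longrightarrow>
    emeasure lebesgue (grid_nbhd b k z :: (real^'n) set) = ennreal ((3 * side b k) ^ CARD('n))"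
  using side_pos[of b k]
  by (intro emeasure_between_boxes[where a = "\<chi> i. side b k * (z $ i - 1)"])
    (auto simp: mem_grid_nbhd_iff mem_box_cart less_imp_le)

text \<open>The side length at scale \<open>k\<close> is an integer multiple of the one at scale
  \<open>j\<close>, so the grids are nested: integer division of the finer floor gives the floor at
  the coarser scale.\<close>

lemma grid_index_coarsen:
  assumes "0 < b" "j \<le> k"
  shows "grid_index b k x $ i = grid_index b j x $ i div int b ^ nat (k - j)"
proof -
  have "side b k = side b j * real_of_int (int b ^ nat (k - j))"
    using assms side_add[of b j "k - j"] by (simp add: side_def powr_realpow [symmetric])
  then have "x $ i / side b k = x $ i / side b j / real_of_int (int b ^ nat (k - j))"
    by simp
  then show ?thesis
    unfolding grid_index_def by (simp only: vec_lambda_beta) (rule floor_divide_real_eq_div, simp)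
qed

lemma grid_index_eq_coarsen:
  assumes "0 < b" "j \<le> k" "grid_index b j x = grid_index b j y"
  shows "grid_index b k x = grid_index b k y"
  using assms by (simp add: vec_eq_iff grid_index_coarsen[OF assms(1,2)])

lemma grid_nbhd_coarsen:
  assumes "0 < b" "j \<le> k"
  shows "grid_nbhd b j (grid_index b j x) \<subseteq> grid_nbhd b k (grid_index b k x)"
proof
  fix y assume y: "y \<in> grid_nbhd b j (grid_index b j x)"
  define B where "B = int b ^ nat (k - j)"
  have B: "0 < B" using assms by (simp add: B_def)
  \<comment> \<open>Indices that differ by at most one still do so after division, since
    \<open>B\<close> is at least \<open>1\<close>.\<close>
  have *: "p div B \<le> q div B + 1" if "p \<le> q + 1" for p q :: int
  proof -
    have "p div B \<le> (q + B) div B" using that B by (intro zdiv_mono1) auto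
    then show ?thesis using B by simp
  qed
  show "y \<in> grid_nbhd b k (grid_index b k x)"
    using y *[of "grid_index b j x $ i" "grid_index b j y $ i" for i]
      *[of "grid_index b j y $ i" "grid_index b j x $ i" for i]
    unfolding grid_nbhd_def mem_Collect_eq grid_index_coarsen[OF assms] B_def[symmetric]
    by (smt (verit))
qed

lemma grid_nbhd_sym: "x \<in> grid_nbhd b k (grid_index b k y) \<longleftrightarrow> y \<in> grid_nbhd b k (grid_index b k x)"
  by (simp add: grid_nbhd_def abs_minus_commute)

lemma grid_nbhdI_norm:
  assumes "0 < b" "norm (x - y) < side b k"
  shows "y \<in> grid_nbhd b k (grid_index b k x)"
proof -
  have s: "0 < side b k" using assms side_pos by simp
  have "\<bar>grid_index b k y $ i - grid_index b k x $ i\<bar> \<le> 1" for i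
  proof -
    have "\<bar>x $ i - y $ i\<bar> < side b k"
      using component_le_norm_cart[of "x - y" i] assms(2) by simp
    then have "\<bar>x $ i / side b k - y $ i / side b k\<bar> < 1"
      using s by (simp add: diff_divide_distrib[symmetric])
    then show ?thesis by (simp add: grid_index_def) linarith
  qed
  then show ?thesis by (simp add: grid_nbhd_def)
qed

text \<open>The cells of one generation partition space, and there are countably many of them, so an
  inequality of integrals may be checked cell by cell.\<close>

lemma nn_integral_le_of_grid_cells:
  fixes g h :: "real^'n \<Rightarrow> ennreal"
  assumes [measurable]: "g \<in> borel_measurable lebesgue" "h \<in> borel_measurable lebesgue"
  assumes le: "\<And>z. (\<integral>\<^sup>+x\<in>grid_cell b k z. g x \<partial>lebesgue) \<le> (\<integral>\<^sup>+x\<in>grid_cell b k z. h x \<partial>lebesgue)"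
  shows "(\<integral>\<^sup>+x. g x \<partial>lebesgue) \<le> (\<integral>\<^sup>+x. h x \<partial>lebesgue)"
proof -
  have *: "(\<integral>\<^sup>+x. g x \<partial>lebesgue) =
      (\<integral>\<^sup>+z. (\<integral>\<^sup>+x\<in>grid_cell b k z. g x \<partial>lebesgue) \<partial>count_space UNIV)"
    if [measurable]: "g \<in> borel_measurable lebesgue" for g :: "real^'n \<Rightarrow> ennreal"
  proof -
    have "(\<integral>\<^sup>+z. g x * indicator (grid_cell b k z) x \<partial>count_space UNIV) = g x" for x
    proof -
      have "(\<lambda>z. g x * indicator (grid_cell b k z) x) =
          (\<lambda>z. g x * indicator {grid_index b k x} z)"
        by (auto simp: indicator_def fun_eq_iff)
      then show ?thesis by (simp add: nn_integral_cmult)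
    qed
    then have "(\<integral>\<^sup>+x. g x \<partial>lebesgue) =
        (\<integral>\<^sup>+x. (\<integral>\<^sup>+z. g x * indicator (grid_cell b k z) x \<partial>count_space UNIV) \<partial>lebesgue)"
      by simp
    also have "\<dots> = (\<integral>\<^sup>+z. (\<integral>\<^sup>+x\<in>grid_cell b k z. g x \<partial>lebesgue) \<partial>count_space UNIV)"
      by (rule nn_integral_count_space_nn_integral) auto
    finally show ?thesis .
  qed
  show ?thesis
    unfolding *[OF assms(1)] *[OF assms(2)] by (intro nn_integral_mono le)
qed

section \<open>Weighted integrals and Luxemburg averages\<close>

lemma mult_INF_geI:
  fixes f :: "'a \<Rightarrow> ennreal"
  assumes "\<And>l. l \<in> S \<Longrightarrow> X \<le> c * f l" and "0 < c" "c < \<infinity>"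
  shows "X \<le> c * (INF l\<in>S. f l)"
proof -
  have c: "c \<noteq> 0" "c \<noteq> top" using assms by auto
  have "X / c \<le> (INF l\<in>S. f l)"
  proof (rule INF_greatest)
    fix l assume "l \<in> S"
    then have "X / c \<le> f l * c / c"
      using assms(1) by (intro divide_right_mono_ennreal) (simp add: mult.commute)
    then show "X / c \<le> f l"
      using c by (simp add: ennreal_mult_divide_eq)
  qed
  then have "X / c * c \<le> (INF l\<in>S. f l) * c"
    by (rule mult_right_mono) simp
  moreover have "X / c * c = X"
    using c by (simp add: ennreal_divide_times ennreal_divide_self less_top)
  ultimately show ?thesis by (simp add: mult.commute)
qed

lemma average_le_oneD:
  assumes "average Q g \<le> 1" "0 < emeasure lebesgue Q" "emeasure lebesgue Q < \<infinity>"
  shows "(\<integral>\<^sup>+y\<in>Q. g y \<partial>lebesgue) \<le> emeasure lebesgue Q"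
proof -
  have "average Q g * emeasure lebesgue Q \<le> 1 * emeasure lebesgue Q"
    using assms by (intro mult_right_mono) auto
  then show ?thesis
    using assms by (simp add: average_def ennreal_divide_times)
qed

lemma measurable_LlogL [measurable]: "LlogL \<delta> \<in> borel_measurable borel"
  unfolding LlogL_def[abs_def] log_plus_def by measurable

text \<open>The set is split according to whether \<open>u\<close> exceeds \<open>\<tau>\<close> times the Luxemburg norm: below this
  level the smallness of \<open>A\<close> is used, above it the logarithm in the Young function.\<close>

lemma set_nn_integral_le_orlicz_average:
  fixes u :: "real^'n \<Rightarrow> real"
  assumes u: "weight u" and \<delta>: "0 < \<delta>" and \<tau>: "1 \<le> \<tau>" and \<epsilon>: "0 < \<epsilon>"
    and Q: "Q \<in> sets lebesgue" "0 < emeasure lebesgue Q" "emeasure lebesgue Q < \<infinity>"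
    and A: "A \<in> sets lebesgue" "A \<subseteq> Q" "emeasure lebesgue A \<le> ennreal \<epsilon> * emeasure lebesgue Q"
  shows "(\<integral>\<^sup>+y\<in>A. ennreal (u y) \<partial>lebesgue)
    \<le> ennreal (\<tau> * \<epsilon> + (1 + ln \<tau>) powr (-\<delta>)) * emeasure lebesgue Q * orlicz_average (LlogL \<delta>) Q u"
  unfolding orlicz_average_def
proof (rule mult_INF_geI)
  have [measurable]: "u \<in> borel_measurable lebesgue" and u0: "\<And>y. 0 \<le> u y"
    using u by (auto simp: weight_def)
  \<comment> \<open>Where \<open>u / l\<close> is at least \<tau>, the logarithm makes the Young
    function of \<open>u / l\<close> at least \<open>1 / p\<close> times
    \<open>u / l\<close>.\<close>
  define p where "p = (1 + ln \<tau>) powr (-\<delta>)"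
  have \<tau>': "0 < 1 + ln \<tau>" using \<tau> by (simp add: add_pos_nonneg)
  then have p: "0 < p" by (simp add: p_def)
  show "0 < ennreal (\<tau> * \<epsilon> + (1 + ln \<tau>) powr (-\<delta>)) * emeasure lebesgue Q"
    using Q \<tau> \<epsilon> p unfolding p_def[symmetric]
    by (auto simp: ennreal_zero_less_mult_iff intro!: add_pos_pos)
  show "ennreal (\<tau> * \<epsilon> + (1 + ln \<tau>) powr (-\<delta>)) * emeasure lebesgue Q < \<infinity>"
    using Q by (simp add: ennreal_mult_less_top)
  fix l assume "l \<in> {l. 0 < l \<and> average Q (\<lambda>y. ennreal (LlogL \<delta> (\<bar>u y\<bar> / l))) \<le> 1}"
  then have l: "0 < l" and av: "average Q (\<lambda>y. ennreal (LlogL \<delta> (\<bar>u y\<bar> / l))) \<le> 1" by auto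
  note int = average_le_oneD[OF av Q(2,3)]
  have B0: "0 \<le> LlogL \<delta> (\<bar>u y\<bar> / l)" for y
    using l by (simp add: LlogL_def)
  have le: "u y \<le> l * \<tau> + l * p * LlogL \<delta> (\<bar>u y\<bar> / l)" for y
  proof (cases "u y \<le> l * \<tau>")
    case True
    then show ?thesis using B0[of y] l p by (intro add_increasing2) auto
  next
    case False
    then have t: "\<tau> \<le> u y / l" using l by (simp add: field_simps)
    then have "ln \<tau> \<le> log_plus (u y / l)"
      using \<tau> by (simp add: log_plus_def le_max_iff_disj)
    then have "(1 + ln \<tau>) powr \<delta> \<le> (1 + log_plus (u y / l)) powr \<delta>"
      using \<tau> \<delta> by (intro powr_mono2) auto
    then have "u y / l * (1 + ln \<tau>) powr \<delta> \<le> LlogL \<delta> (\<bar>u y\<bar> / l)"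
      using u0[of y] l by (simp add: LlogL_def mult_left_mono divide_right_mono)
    then have "l * p * (u y / l * (1 + ln \<tau>) powr \<delta>) \<le> l * p * LlogL \<delta> (\<bar>u y\<bar> / l)"
      using l p by (intro mult_left_mono) auto
    moreover have "p * (1 + ln \<tau>) powr \<delta> = 1"
      using \<tau>' by (simp add: p_def powr_minus field_simps)
    then have "l * p * (u y / l * (1 + ln \<tau>) powr \<delta>) = u y"
      using l by (simp add: field_simps del: mult_eq_0_iff mult_cancel_left1 mult_cancel_left2)
    ultimately have "u y \<le> l * p * LlogL \<delta> (\<bar>u y\<bar> / l)" by simp
    then show ?thesis using l \<tau> by (intro add_increasing) auto
  qed
  have "(\<integral>\<^sup>+y\<in>A. ennreal (u y) \<partial>lebesgue) \<le>
      (\<integral>\<^sup>+y. ennreal (l * \<tau>) * indicator A y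
        + ennreal (l * p) * (ennreal (LlogL \<delta> (\<bar>u y\<bar> / l)) * indicator Q y) \<partial>lebesgue)"
  proof (rule nn_integral_mono)
    fix y
    have "ennreal (u y) \<le> ennreal (l * \<tau> + l * p * LlogL \<delta> (\<bar>u y\<bar> / l))"
      using le by (rule ennreal_leI)
    also have "\<dots> = ennreal (l * \<tau>) + ennreal (l * p) * ennreal (LlogL \<delta> (\<bar>u y\<bar> / l))"
      using l \<tau> p B0 by (simp add: ennreal_plus ennreal_mult)
    finally show "ennreal (u y) * indicator A y \<le> ennreal (l * \<tau>) * indicator A y
        + ennreal (l * p) * (ennreal (LlogL \<delta> (\<bar>u y\<bar> / l)) * indicator Q y)"
      using A(2) by (auto simp: indicator_def)
  qed
  also have "\<dots> = ennreal (l * \<tau>) * emeasure lebesgue A +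
      ennreal (l * p) * (\<integral>\<^sup>+y\<in>Q. ennreal (LlogL \<delta> (\<bar>u y\<bar> / l)) \<partial>lebesgue)"
    using A Q by (simp add: nn_integral_add nn_integral_cmult)
  also have "\<dots> \<le> ennreal (l * \<tau>) * (ennreal \<epsilon> * emeasure lebesgue Q) +
      ennreal (l * p) * emeasure lebesgue Q"
    by (intro add_mono mult_left_mono A int) auto
  also have "\<dots> = ennreal (\<tau> * \<epsilon> + p) * emeasure lebesgue Q * ennreal l"
    using l \<tau> \<epsilon> p by (simp add: ennreal_mult ennreal_plus algebra_simps)
  finally show "(\<integral>\<^sup>+y\<in>A. ennreal (u y) \<partial>lebesgue)
    \<le> ennreal (\<tau> * \<epsilon> + (1 + ln \<tau>) powr (-\<delta>)) * emeasure lebesgue Q * ennreal l"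
    by (simp add: p_def)
qed

text \<open>The overlapping sets \<open>B k\<close> are traded cell by cell for the disjoint sets \<open>E k\<close>: on a cell the
  left side costs the Luxemburg norm, which is at most the maximal function at every point of the cell.\<close>

lemma sum_set_nn_integral_le_orlicz_maximal:
  fixes u :: "real^'n \<Rightarrow> real" and B E :: "int \<Rightarrow> (real^'n) set"
  assumes u: "weight u" and \<delta>: "0 < \<delta>" and \<tau>: "1 \<le> \<tau>" and \<epsilon>: "0 < \<epsilon>" and b: "0 < b"
    and B [measurable]: "\<And>k. B k \<in> sets lebesgue" and E [measurable]: "\<And>k. E k \<in> sets lebesgue"
    and disj: "disjoint_family E" and \<Omega>: "\<And>k. E k \<subseteq> \<Omega>"
    and small: "\<And>k z. B k \<inter> grid_cell b k z \<noteq> {} \<Longrightarrow>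
      emeasure lebesgue (B k \<inter> grid_cell b k z) \<le> ennreal \<epsilon> * emeasure lebesgue (grid_cell b k z)"
    and large: "\<And>k z. B k \<inter> grid_cell b k z \<noteq> {} \<Longrightarrow>
      emeasure lebesgue (grid_cell b k z) \<le> 2 * emeasure lebesgue (E k \<inter> grid_cell b k z)"
  shows "(\<integral>\<^sup>+k. (\<integral>\<^sup>+x\<in>B k. ennreal (u x) \<partial>lebesgue) \<partial>count_space UNIV)
    \<le> ennreal (2 * (\<tau> * \<epsilon> + (1 + ln \<tau>) powr (-\<delta>))) *
      (\<integral>\<^sup>+x\<in>\<Omega>. orlicz_maximal (LlogL \<delta>) u x \<partial>lebesgue)"
proof -
  have [measurable]: "u \<in> borel_measurable lebesgue"
    using u by (auto simp: weight_def)
  define U where "U k z = orlicz_average (LlogL \<delta>) (grid_cube b k z) u" for k z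
  define \<kappa> where "\<kappa> = \<tau> * \<epsilon> + (1 + ln \<tau>) powr (-\<delta>)"
  have \<kappa>: "0 \<le> \<kappa>" using \<tau> \<epsilon> by (simp add: \<kappa>_def)
  have Q: "grid_cube b k z \<in> sets lebesgue" "0 < emeasure lebesgue (grid_cube b k z)"
    "emeasure lebesgue (grid_cube b k z) < \<infinity>" for k and z :: "int^'n"
    using b side_pos[of b k]
    by (simp_all add: emeasure_grid_cube) (simp add: grid_cube_def)
  have one: "(\<integral>\<^sup>+x\<in>B k. ennreal (u x) \<partial>lebesgue) \<le>
      ennreal (2 * \<kappa>) * (\<integral>\<^sup>+x\<in>E k. U k (grid_index b k x) \<partial>lebesgue)" for k
  proof -
    have "(\<integral>\<^sup>+x. ennreal (u x) * indicator (B k) x \<partial>lebesgue) \<le>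
        (\<integral>\<^sup>+x. ennreal (2 * \<kappa>) * (U k (grid_index b k x) * indicator (E k) x) \<partial>lebesgue)"
    proof (rule nn_integral_le_of_grid_cells[where b = b and k = k])
      fix z :: "int^'n"
      have eq: "(\<integral>\<^sup>+x\<in>grid_cell b k z.
          (ennreal (2 * \<kappa>) * (U k (grid_index b k x) * indicator (E k) x)) \<partial>lebesgue) =
          ennreal (2 * \<kappa>) * (U k z * emeasure lebesgue (E k \<inter> grid_cell b k z))"
      proof -
        have "(\<integral>\<^sup>+x\<in>grid_cell b k z.
            (ennreal (2 * \<kappa>) * (U k (grid_index b k x) * indicator (E k) x)) \<partial>lebesgue) =
            (\<integral>\<^sup>+x. ennreal (2 * \<kappa>) * (U k z * indicator (E k \<inter> grid_cell b k z) x) \<partial>lebesgue)"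
          by (intro nn_integral_cong) (auto simp: indicator_def)
        then show ?thesis by (simp add: nn_integral_cmult)
      qed
      have eq': "(\<integral>\<^sup>+x\<in>grid_cell b k z. (ennreal (u x) * indicator (B k) x) \<partial>lebesgue) =
          (\<integral>\<^sup>+x\<in>B k \<inter> grid_cell b k z. ennreal (u x) \<partial>lebesgue)"
        by (intro nn_integral_cong) (auto simp: indicator_def)
      show "(\<integral>\<^sup>+x\<in>grid_cell b k z. (ennreal (u x) * indicator (B k) x) \<partial>lebesgue) \<le>
        (\<integral>\<^sup>+x\<in>grid_cell b k z.
          (ennreal (2 * \<kappa>) * (U k (grid_index b k x) * indicator (E k) x)) \<partial>lebesgue)"
        unfolding eq eq'
      proof (cases "B k \<inter> grid_cell b k z = {}")
        case False
        note c = emeasure_grid_cell[OF b, of k z] emeasure_grid_cube[OF b, of k z]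
        have "(\<integral>\<^sup>+x\<in>B k \<inter> grid_cell b k z. ennreal (u x) \<partial>lebesgue)
          \<le> ennreal \<kappa> * emeasure lebesgue (grid_cube b k z) * U k z"
          unfolding \<kappa>_def U_def
          using small[OF False] c grid_cell_subset_cube[OF b, of k z]
          by (intro set_nn_integral_le_orlicz_average[OF u \<delta> \<tau> \<epsilon> Q]) auto
        \<comment> \<open>A cell and its closed cube have equal volume, so the volume of the cube
          may be replaced by twice that of the part of \<open>E k\<close> in the cell.\<close>
        also have "\<dots> \<le> ennreal \<kappa> * (2 * emeasure lebesgue (E k \<inter> grid_cell b k z)) * U k z"
          using large[OF False] c by (intro mult_left_mono mult_right_mono) auto
        also have "\<dots> = ennreal (2 * \<kappa>) * (U k z * emeasure lebesgue (E k \<inter> grid_cell b k z))"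
          using \<kappa> by (simp add: ennreal_mult ac_simps)
        finally show "(\<integral>\<^sup>+x\<in>B k \<inter> grid_cell b k z. ennreal (u x) \<partial>lebesgue)
          \<le> ennreal (2 * \<kappa>) * (U k z * emeasure lebesgue (E k \<inter> grid_cell b k z))" .
      qed auto
    qed auto
    then show ?thesis by (simp add: nn_integral_cmult)
  qed
  have "(\<integral>\<^sup>+k. (\<integral>\<^sup>+x\<in>B k. ennreal (u x) \<partial>lebesgue) \<partial>count_space UNIV) \<le>
      (\<integral>\<^sup>+k. ennreal (2 * \<kappa>) * (\<integral>\<^sup>+x\<in>E k. U k (grid_index b k x) \<partial>lebesgue) \<partial>count_space UNIV)"
    by (intro nn_integral_mono one)
  also have "\<dots> = ennreal (2 * \<kappa>) *
      (\<integral>\<^sup>+k. (\<integral>\<^sup>+x\<in>E k. U k (grid_index b k x) \<partial>lebesgue) \<partial>count_space UNIV)"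
    by (simp add: nn_integral_cmult)
  also have "(\<integral>\<^sup>+k. (\<integral>\<^sup>+x\<in>E k. U k (grid_index b k x) \<partial>lebesgue) \<partial>count_space UNIV) =
      (\<integral>\<^sup>+x. (\<integral>\<^sup>+k. U k (grid_index b k x) * indicator (E k) x \<partial>count_space UNIV) \<partial>lebesgue)"
    by (rule nn_integral_count_space_nn_integral[symmetric]) auto
  also have "\<dots> \<le> (\<integral>\<^sup>+x\<in>\<Omega>. orlicz_maximal (LlogL \<delta>) u x \<partial>lebesgue)"
  proof (rule nn_integral_mono)
    fix x
    show "(\<integral>\<^sup>+k. U k (grid_index b k x) * indicator (E k) x \<partial>count_space UNIV)
      \<le> orlicz_maximal (LlogL \<delta>) u x * indicator \<Omega> x"
    proof (cases "\<exists>k. x \<in> E k")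
      case True
      \<comment> \<open>By disjointness only the scale \<open>k0\<close> contributes at
        \<open>x\<close>, and the closed cube of that scale contains \<open>x\<close>, so it
        competes in the supremum.\<close>
      then obtain k0 where k0: "x \<in> E k0" by blast
      have "x \<in> E k \<longleftrightarrow> k = k0" for k
        using disj k0 by (auto simp: disjoint_family_on_def)
      then have "(\<lambda>k. U k (grid_index b k x) * indicator (E k) x) =
          (\<lambda>k. U k0 (grid_index b k0 x) * indicator {k0} k)"
        by (auto simp: indicator_def fun_eq_iff)
      then have "(\<integral>\<^sup>+k. U k (grid_index b k x) * indicator (E k) x \<partial>count_space UNIV) =
          U k0 (grid_index b k0 x)"
        by (simp add: nn_integral_cmult)
      also have "\<dots> \<le> orlicz_maximal (LlogL \<delta>) u x"
        unfolding U_def orlicz_maximal_def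
        using cube_grid_cube[OF b] grid_cell_subset_cube[OF b, of k0 "grid_index b k0 x"]
        by (intro SUP_upper) auto
      finally show ?thesis using k0 \<Omega>[of k0] by (simp add: subset_iff)
    next
      case False
      then have "(\<lambda>k. U k (grid_index b k x) * indicator (E k) x) = (\<lambda>k. 0)"
        by (simp add: fun_eq_iff)
      then show ?thesis by simp
    qed
  qed
  finally show ?thesis unfolding \<kappa>_def by (simp add: mult_left_mono)
qed

section \<open>Weights of overlapping and of maximal selected cells\<close>

lemma packing_tail:
  fixes P :: "int \<Rightarrow> int^'n \<Rightarrow> bool"
  assumes packing: "\<And>i. 1 \<le> i \<Longrightarrow>
      emeasure lebesgue {x \<in> grid_cell b k z. P (k - int i) (grid_index b (k - int i) x)}
        \<le> ennreal ((1/8) ^ i) * emeasure lebesgue (grid_cell b k z)"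
    and s: "1 \<le> s"
  shows "emeasure lebesgue {x \<in> grid_cell b k z. \<exists>i\<ge>s. P (k - int i) (grid_index b (k - int i) x)}
    \<le> ennreal (8 / 7 * (1/8) ^ s) * emeasure lebesgue (grid_cell b k z)"
proof -
  define D where "D i = {x \<in> grid_cell b k z. P (k - int i) (grid_index b (k - int i) x)}" for i
  have [measurable]: "D i \<in> sets lebesgue" for i
  proof -
    have "D i = grid_cell b k z \<inter> {x. P (k - int i) (grid_index b (k - int i) x)}"
      by (auto simp: D_def)
    then show ?thesis by (simp add: sets_grid_index sets_grid_cell sets.Int)
  qed
  \<comment> \<open>A union bound over all generations from \<open>s\<close> on leads to a geometric
    series with ratio \<open>1/8\<close>.\<close>
  have "{x \<in> grid_cell b k z. \<exists>i\<ge>s. P (k - int i) (grid_index b (k - int i) x)} \<subseteq> (\<Union>i. D (i + s))"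
    by (auto simp: D_def le_iff_add ac_simps)
  then have "emeasure lebesgue {x \<in> grid_cell b k z. \<exists>i\<ge>s. P (k - int i) (grid_index b (k - int i) x)}
      \<le> emeasure lebesgue (\<Union>i. D (i + s))"
    by (intro emeasure_mono) auto
  also have "\<dots> \<le> (\<Sum>i. emeasure lebesgue (D (i + s)))"
    by (rule emeasure_subadditive_countably) auto
  also have "\<dots> \<le> (\<Sum>i. ennreal ((1/8) ^ (i + s)) * emeasure lebesgue (grid_cell b k z))"
    unfolding D_def using s by (intro suminf_le packing) auto
  also have "\<dots> = (\<Sum>i. ennreal ((1/8) ^ (i + s))) * emeasure lebesgue (grid_cell b k z)"
    by (rule ennreal_suminf_multc)
  also have "(\<Sum>i. ennreal ((1/8) ^ (i + s))) = ennreal (8 / 7 * (1/8) ^ s)"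
  proof (rule suminf_ennreal_eq)
    have "(\<lambda>i. (1/8 :: real) ^ i * (1/8) ^ s) sums (1 / (1 - 1/8) * (1/8) ^ s)"
      by (intro sums_mult2 geometric_sums) simp
    then show "(\<lambda>i. (1/8 :: real) ^ (i + s)) sums (8 / 7 * (1/8) ^ s)"
      by (simp add: power_add)
  qed simp
  finally show ?thesis .
qed

text \<open>Among \<open>2 * s\<close> elements of \<open>K\<close> at most \<open>s\<close> lie
  less than \<open>s\<close> above the smallest one; the others have it at distance at least
  \<open>s\<close> below them. The count is a measure because it may be infinite.\<close>

lemma card_overlap_ge:
  fixes K :: "int set"
  assumes "\<not> (finite K \<and> card K < 2 * s)"
  shows "of_nat s \<le> emeasure (count_space UNIV) {k \<in> K. \<exists>i\<ge>s. k - int i \<in> K}"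
proof -
  define S where "S = {k \<in> K. \<exists>i\<ge>s. k - int i \<in> K}"
  obtain T where T: "T \<subseteq> K" "finite T" "card T = 2 * s"
    using assms by (metis infinite_arbitrarily_large not_less obtain_subset_with_card_n)
  define T' where "T' = T - {Min T..<Min T + int s}"
  have "T' \<subseteq> S"
  proof
    fix k assume k: "k \<in> T'"
    then have "k \<in> T" by (simp add: T'_def)
    moreover have "Min T \<le> k" using \<open>k \<in> T\<close> T by simp
    moreover have "Min T \<in> T" using \<open>k \<in> T\<close> T by (intro Min_in) auto
    ultimately show "k \<in> S"
      using k T by (auto simp: S_def T'_def intro!: exI[of _ "nat (k - Min T)"])
  qed
  moreover have "s \<le> card T'"
    using T diff_card_le_card_Diff[of "{Min T..<Min T + int s}" T] by (simp add: T'_def)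
  ultimately have "of_nat s \<le> emeasure (count_space UNIV) S"
    using card_mono[of S T'] by (cases "finite S") (auto simp: emeasure_count_space)
  then show ?thesis by (simp add: S_def)
qed

text \<open>If \<open>x\<close> lies in \<open>2 s\<close> selected cells, then at least \<open>s\<close> of them contain, \<open>s\<close> or more generations
  below, a further selected cell around \<open>x\<close>. Packing makes that part of a cell exponentially small in
  \<open>s\<close>, so its weight gains \<open>s powr (-\<delta>)\<close>; the other factor \<open>1 / s\<close> is Chebyshev's inequality.\<close>

lemma weak_overlap_bound:
  fixes u :: "real^'n \<Rightarrow> real" and P :: "int \<Rightarrow> int^'n \<Rightarrow> bool"
  assumes u: "weight u" and \<delta>: "0 < \<delta>" and b: "0 < b" and s: "1 \<le> s"
    and packing: "\<And>k z i. P k z \<Longrightarrow> 1 \<le> i \<Longrightarrow>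
      emeasure lebesgue {x \<in> grid_cell b k z. P (k - int i) (grid_index b (k - int i) x)}
        \<le> ennreal ((1/8) ^ i) * emeasure lebesgue (grid_cell b k z)"
    and \<Omega>: "\<And>x k. P k (grid_index b k x) \<Longrightarrow> x \<in> \<Omega>"
  obtains H where "H \<in> sets lebesgue"
    "\<And>x. x \<notin> H \<Longrightarrow> finite {k. P k (grid_index b k x)} \<and> card {k. P k (grid_index b k x)} < 2 * s"
    "(\<integral>\<^sup>+x\<in>H. ennreal (u x) \<partial>lebesgue)
      \<le> ennreal (2 * (2 * (1/4) ^ s + (1 + real s * ln 2) powr (-\<delta>)) / real s) *
        (\<integral>\<^sup>+x\<in>\<Omega>. orlicz_maximal (LlogL \<delta>) u x \<partial>lebesgue)"
proof -
  have [measurable]: "u \<in> borel_measurable lebesgue"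
    using u by (auto simp: weight_def)
  define A where "A k = {x. P k (grid_index b k x)}" for k
  have [measurable]: "A k \<in> sets lebesgue" for k
    unfolding A_def by (rule sets_grid_index)
  \<comment> \<open>\<open>A k\<close> is the union of the selected cells of generation
    \<open>k\<close>, and \<open>tail r k\<close> collects those that are at least \<open>r\<close>
    generations finer.\<close>
  define tail where "tail r k = (\<Union>i\<in>{r..}. A (k - int i))" for r k
  have [measurable]: "tail r k \<in> sets lebesgue" for r k
    unfolding tail_def by (intro sets.countable_UN') auto
  define B where "B k = A k \<inter> tail s k" for k
  \<comment> \<open>The points whose finest selected cell has generation \<open>k\<close>; this is
    what makes the sets disjoint.\<close>
  define E where "E k = A k - tail 1 k" for k
  have [measurable]: "B k \<in> sets lebesgue" "E k \<in> sets lebesgue" for k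
    by (simp_all add: B_def E_def)
  define M where "M x = (\<integral>\<^sup>+k. indicator (B k) x \<partial>count_space UNIV)" for x
  have [measurable]: "M \<in> borel_measurable lebesgue"
  proof -
    interpret C: sigma_finite_measure "count_space (UNIV :: int set)"
      by (rule sigma_finite_measure_count_space)
    have "(\<lambda>(k, x). indicator (B k) x :: ennreal) \<in> borel_measurable (count_space UNIV \<Otimes>\<^sub>M lebesgue)"
      by (rule measurable_pair_measure_countable1) auto
    then have "(\<lambda>(x, k). indicator (B k) x :: ennreal) \<in> borel_measurable (lebesgue \<Otimes>\<^sub>M count_space UNIV)"
      by (subst measurable_pair_swap_iff) (simp add: case_prod_beta')
    then show ?thesis
      unfolding M_def[abs_def] by (rule C.borel_measurable_nn_integral)
  qed
  define H where "H = {x. of_nat s \<le> M x}"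
  have [measurable]: "H \<in> sets lebesgue"
  proof -
    have "{x \<in> space lebesgue. of_nat s \<le> M x} \<in> sets lebesgue" by measurable
    then show ?thesis by (simp add: H_def)
  qed
  have tail: "emeasure lebesgue (tail r k \<inter> grid_cell b k z)
      \<le> ennreal (8 / 7 * (1/8) ^ r) * emeasure lebesgue (grid_cell b k z)"
    if "P k z" "1 \<le> r" for k z r
  proof -
    have "tail r k \<inter> grid_cell b k z =
        {x \<in> grid_cell b k z. \<exists>i\<ge>r. P (k - int i) (grid_index b (k - int i) x)}"
      by (auto simp: tail_def A_def)
    then show ?thesis
      using packing_tail[of b k z P r] packing[OF that(1)] that(2) by simp
  qed
  have "(\<integral>\<^sup>+k. (\<integral>\<^sup>+x\<in>B k. ennreal (u x) \<partial>lebesgue) \<partial>count_space UNIV)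
    \<le> ennreal (2 * (2 ^ s * (2 * (1/8) ^ s) + (1 + ln (2 ^ s)) powr (-\<delta>))) *
      (\<integral>\<^sup>+x\<in>\<Omega>. orlicz_maximal (LlogL \<delta>) u x \<partial>lebesgue)"
  \<comment> \<open>Taking \<open>2 ^ s\<close> for \<tau> serves both terms: against the smallness
    \<open>2 * (1/8) ^ s\<close> it still leaves exponential decay, while its logarithm is
    proportional to \<open>s\<close>.\<close>
  proof (rule sum_set_nn_integral_le_orlicz_maximal[OF u \<delta>, where b = b and E = E])
    have "E k \<inter> E j = {}" if "k < j" for k j
    proof -
      have "A k \<subseteq> tail 1 j"
        using that by (auto simp: tail_def intro!: bexI[of _ "nat (j - k)"])
      then show ?thesis by (auto simp: E_def)
    qed
    then show "disjoint_family E"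
      by (metis disjoint_family_on_def Int_commute neqE)
    show "E k \<subseteq> \<Omega>" for k
      using \<Omega> by (auto simp: E_def A_def)
    fix k and z :: "int^'n" assume ne: "B k \<inter> grid_cell b k z \<noteq> {}"
    then have P: "P k z" by (auto simp: B_def A_def)
    have "emeasure lebesgue (B k \<inter> grid_cell b k z) \<le> emeasure lebesgue (tail s k \<inter> grid_cell b k z)"
      by (intro emeasure_mono) (auto simp: B_def)
    also have "\<dots> \<le> ennreal (8 / 7 * (1/8) ^ s) * emeasure lebesgue (grid_cell b k z)"
      by (rule tail[OF P s])
    also have "\<dots> \<le> ennreal (2 * (1/8) ^ s) * emeasure lebesgue (grid_cell b k z)"
      by (intro mult_right_mono ennreal_leI) auto
    finally show "emeasure lebesgue (B k \<inter> grid_cell b k z)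
      \<le> ennreal (2 * (1/8) ^ s) * emeasure lebesgue (grid_cell b k z)" .
    define c where "c = side b k ^ CARD('n)"
    have c: "emeasure lebesgue (grid_cell b k z) = ennreal c" "0 < c"
      unfolding c_def by (rule emeasure_grid_cell[OF b]) (simp add: side_pos[OF b])
    \<comment> \<open>The finer selected cells cover at most \<open>8/7 * 1/8 = 1/7\<close> of the
      cell, so more than half of it is left for \<open>E k\<close>.\<close>
    have "grid_cell b k z \<subseteq> (E k \<inter> grid_cell b k z) \<union> (tail 1 k \<inter> grid_cell b k z)"
      using P by (auto simp: E_def A_def)
    then have "ennreal c \<le> emeasure lebesgue ((E k \<inter> grid_cell b k z) \<union> (tail 1 k \<inter> grid_cell b k z))"
      unfolding c(1)[symmetric] by (intro emeasure_mono) auto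
    also have "\<dots> \<le> emeasure lebesgue (E k \<inter> grid_cell b k z) + emeasure lebesgue (tail 1 k \<inter> grid_cell b k z)"
      by (intro emeasure_subadditive) auto
    also have "\<dots> \<le> emeasure lebesgue (E k \<inter> grid_cell b k z) + ennreal (c / 7)"
      using tail[OF P, of 1] c by (intro add_left_mono) (simp add: ennreal_mult[symmetric])
    finally show "emeasure lebesgue (grid_cell b k z) \<le> 2 * emeasure lebesgue (E k \<inter> grid_cell b k z)"
      unfolding c(1) using c(2)
      by (cases "emeasure lebesgue (E k \<inter> grid_cell b k z)")
        (auto simp: ennreal_plus[symmetric] ennreal_mult_top numeral_mult_ennreal
          simp del: ennreal_plus)
  qed (use b in auto)
  also have "2 ^ s * (2 * (1/8) ^ s) = 2 * (1/4 :: real) ^ s"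
    by (simp add: power_mult_distrib[symmetric])
  finally have sum: "(\<integral>\<^sup>+k. (\<integral>\<^sup>+x\<in>B k. ennreal (u x) \<partial>lebesgue) \<partial>count_space UNIV)
    \<le> ennreal (2 * (2 * (1/4) ^ s + (1 + real s * ln 2) powr (-\<delta>))) *
      (\<integral>\<^sup>+x\<in>\<Omega>. orlicz_maximal (LlogL \<delta>) u x \<partial>lebesgue)"
    by (simp add: ln_realpow)
  have "(\<integral>\<^sup>+x\<in>H. ennreal (u x) \<partial>lebesgue) \<le> (\<integral>\<^sup>+x. ennreal (1 / real s) * (M x * ennreal (u x)) \<partial>lebesgue)"
  proof (rule nn_integral_mono)
    fix x
    show "ennreal (u x) * indicator H x \<le> ennreal (1 / real s) * (M x * ennreal (u x))"
    proof (cases "x \<in> H")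
      case True
      have "1 = ennreal (1 / real s) * of_nat s"
        using s by (simp add: ennreal_of_nat_eq_real_of_nat ennreal_mult[symmetric])
      also have "\<dots> \<le> ennreal (1 / real s) * M x"
        using True by (intro mult_left_mono) (auto simp: H_def)
      finally have "1 * ennreal (u x) \<le> ennreal (1 / real s) * M x * ennreal (u x)"
        by (rule mult_right_mono) simp
      then show ?thesis using True by (simp add: mult.assoc)
    qed simp
  qed
  also have "\<dots> = ennreal (1 / real s) * (\<integral>\<^sup>+x. M x * ennreal (u x) \<partial>lebesgue)"
    by (simp add: nn_integral_cmult)
  also have "(\<integral>\<^sup>+x. M x * ennreal (u x) \<partial>lebesgue) =
      (\<integral>\<^sup>+x. (\<integral>\<^sup>+k. ennreal (u x) * indicator (B k) x \<partial>count_space UNIV) \<partial>lebesgue)"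
    by (simp add: M_def nn_integral_cmult mult.commute)
  also have "\<dots> = (\<integral>\<^sup>+k. (\<integral>\<^sup>+x\<in>B k. ennreal (u x) \<partial>lebesgue) \<partial>count_space UNIV)"
    by (rule nn_integral_count_space_nn_integral) auto
  also have "ennreal (1 / real s) * \<dots> \<le> ennreal (1 / real s) *
      (ennreal (2 * (2 * (1/4) ^ s + (1 + real s * ln 2) powr (-\<delta>))) *
        (\<integral>\<^sup>+x\<in>\<Omega>. orlicz_maximal (LlogL \<delta>) u x \<partial>lebesgue))"
    by (intro mult_left_mono sum) simp
  also have "\<dots> = ennreal (2 * (2 * (1/4) ^ s + (1 + real s * ln 2) powr (-\<delta>)) / real s) *
        (\<integral>\<^sup>+x\<in>\<Omega>. orlicz_maximal (LlogL \<delta>) u x \<partial>lebesgue)"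
    unfolding mult.assoc[symmetric] by (subst ennreal_mult[symmetric]) simp_all
  finally have int: "(\<integral>\<^sup>+x\<in>H. ennreal (u x) \<partial>lebesgue) \<le> \<dots>" .
  have "finite {k. P k (grid_index b k x)} \<and> card {k. P k (grid_index b k x)} < 2 * s"
    if x: "x \<notin> H" for x
  proof (rule ccontr)
    assume "\<not> ?thesis"
    from card_overlap_ge[OF this]
    have "of_nat s \<le> emeasure (count_space UNIV) {k. x \<in> B k}"
      by (rule order_trans[OF _ eq_refl])
        (auto simp: B_def A_def tail_def intro!: arg_cong[where f = "emeasure _"])
    also have "\<dots> = M x"
    proof -
      have "M x = (\<integral>\<^sup>+k. indicator {k. x \<in> B k} k \<partial>count_space UNIV)"
        unfolding M_def by (intro nn_integral_cong) (simp add: indicator_def)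
      then show ?thesis by simp
    qed
    finally show False using x by (simp add: H_def)
  qed
  with int show thesis by (intro that[of H]) auto
qed

text \<open>Without packing there need not be maximal selected cells, hence the truncation at scale \<open>N\<close>.\<close>

lemma weak_top_bound:
  fixes u :: "real^'n \<Rightarrow> real" and P :: "int \<Rightarrow> int^'n \<Rightarrow> bool"
  assumes u: "weight u" and \<delta>: "0 < \<delta>" and b: "0 < b"
    and \<Omega>: "\<And>x k. P k (grid_index b k x) \<Longrightarrow> x \<in> \<Omega>"
  shows "(\<integral>\<^sup>+x\<in>{x. \<exists>k. P k (grid_index b k x)}. ennreal (u x) \<partial>lebesgue)
      \<le> 4 * (\<integral>\<^sup>+x\<in>\<Omega>. orlicz_maximal (LlogL \<delta>) u x \<partial>lebesgue)"
proof -
  have [measurable]: "u \<in> borel_measurable lebesgue"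
    using u by (auto simp: weight_def)
  define A where "A k = {x. P k (grid_index b k x)}" for k
  have [measurable]: "A k \<in> sets lebesgue" for k
    unfolding A_def by (rule sets_grid_index)
  define V where "V = (\<integral>\<^sup>+x\<in>\<Omega>. orlicz_maximal (LlogL \<delta>) u x \<partial>lebesgue)"
  define G where "G N = (\<Union>k\<in>{..int N}. A k)" for N :: nat
  have [measurable]: "G N \<in> sets lebesgue" for N
    unfolding G_def by (intro sets.countable_UN') auto
  have bound: "(\<integral>\<^sup>+x\<in>G N. ennreal (u x) \<partial>lebesgue) \<le> 4 * V" for N
  proof -
    \<comment> \<open>The union of the selected cells of generation \<open>k\<close> that are
      maximal among those of generation at most \<open>N\<close>.\<close>
    define E where "E k = (if k \<le> int N then A k - (\<Union>j\<in>{k<..int N}. A j) else {})" for k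
    have [measurable]: "E k \<in> sets lebesgue" for k
      unfolding E_def by (cases "k \<le> int N") (auto intro!: sets.countable_UN')
    have "E k \<inter> E j = {}" if "k < j" for k j
      using that by (auto simp: E_def)
    then have disj: "disjoint_family E"
      by (metis disjoint_family_on_def Int_commute neqE)
    \<comment> \<open>All points of a cell have the same coarser cells, so maximality is a property
      of the whole cell.\<close>
    have cell: "grid_cell b k z \<subseteq> E k" if "E k \<inter> grid_cell b k z \<noteq> {}" for k and z :: "int^'n"
    proof
      fix y assume y: "y \<in> grid_cell b k z"
      obtain x where x: "x \<in> E k" "x \<in> grid_cell b k z" using \<open>E k \<inter> _ \<noteq> {}\<close> by blast
      have "grid_index b j y = grid_index b j x" if "k \<le> j" for j
        using x y by (intro grid_index_eq_coarsen[OF b that]) simp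
      then show "y \<in> E k"
        using x by (auto simp: E_def A_def split: if_splits)
    qed
    have "(\<integral>\<^sup>+x\<in>G N. ennreal (u x) \<partial>lebesgue) \<le>
      (\<integral>\<^sup>+x. (\<integral>\<^sup>+k. ennreal (u x) * indicator (E k) x \<partial>count_space UNIV) \<partial>lebesgue)"
    proof (rule nn_integral_mono)
      fix x
      show "ennreal (u x) * indicator (G N) x \<le>
          (\<integral>\<^sup>+k. ennreal (u x) * indicator (E k) x \<partial>count_space UNIV)"
      proof (cases "x \<in> G N")
        case True
        then obtain k where k: "k \<le> int N" "x \<in> A k" by (auto simp: G_def)
        define S where "S = {j. k \<le> j \<and> j \<le> int N \<and> x \<in> A j}"
        have S: "finite S" "S \<noteq> {}"
          using k by (auto simp: S_def intro: finite_subset[of _ "{k..int N}"])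
        then have "Max S \<in> S" by simp
        then have mS: "k \<le> Max S" "Max S \<le> int N" "x \<in> A (Max S)" by (simp_all add: S_def)
        have "x \<notin> A j" if "Max S < j" "j \<le> int N" for j
        proof
          assume "x \<in> A j"
          then have "j \<in> S" using that mS(1) by (simp add: S_def)
          then have "j \<le> Max S" using S by simp
          then show False using that by simp
        qed
        then have "x \<in> E (Max S)"
          using mS by (auto simp: E_def)
        then have "ennreal (u x) * indicator (G N) x =
            (\<integral>\<^sup>+j. ennreal (u x) * indicator {Max S} j \<partial>count_space UNIV)"
          using True by (simp add: nn_integral_cmult)
        also have "\<dots> \<le> (\<integral>\<^sup>+k. ennreal (u x) * indicator (E k) x \<partial>count_space UNIV)"
          using \<open>x \<in> E (Max S)\<close> by (intro nn_integral_mono) (auto simp: indicator_def)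
        finally show ?thesis .
      qed simp
    qed
    also have "\<dots> = (\<integral>\<^sup>+k. (\<integral>\<^sup>+x\<in>E k. ennreal (u x) \<partial>lebesgue) \<partial>count_space UNIV)"
      by (rule nn_integral_count_space_nn_integral) auto
    also have "\<dots> \<le> ennreal (2 * (1 * 1 + (1 + ln 1) powr (-\<delta>))) * V"
      unfolding V_def
    \<comment> \<open>The disjoint sets serve as both families, with \<tau> and \<epsilon> equal to
      \<open>1\<close>; this gives the constant \<open>4\<close>.\<close>
    proof (rule sum_set_nn_integral_le_orlicz_maximal[OF u \<delta>, where b = b and E = E])
      show "E k \<subseteq> \<Omega>" for k
        using \<Omega> by (auto simp: E_def A_def split: if_splits)
      fix k and z :: "int^'n" assume ne: "E k \<inter> grid_cell b k z \<noteq> {}"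
      then have "E k \<inter> grid_cell b k z = grid_cell b k z"
        using cell by blast
      then show "emeasure lebesgue (E k \<inter> grid_cell b k z) \<le> ennreal 1 * emeasure lebesgue (grid_cell b k z)"
        "emeasure lebesgue (grid_cell b k z) \<le> 2 * emeasure lebesgue (E k \<inter> grid_cell b k z)"
        by (auto simp: mult_2)
    qed (use b disj in auto)
    finally show ?thesis by simp
  qed
  \<comment> \<open>Monotone convergence removes the truncation, as the bound does not depend on
    \<open>N\<close>.\<close>
  have "incseq (\<lambda>N x. ennreal (u x) * indicator (G N) x)"
    unfolding incseq_def le_fun_def G_def by (auto simp: indicator_def)
  then have "(\<integral>\<^sup>+x. (SUP N. ennreal (u x) * indicator (G N) x) \<partial>lebesgue) =
      (SUP N. \<integral>\<^sup>+x\<in>G N. ennreal (u x) \<partial>lebesgue)"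
    by (rule nn_integral_monotone_convergence_SUP) auto
  also have "\<dots> \<le> 4 * V" by (intro SUP_least bound)
  finally have "(\<integral>\<^sup>+x. (SUP N. ennreal (u x) * indicator (G N) x) \<partial>lebesgue) \<le> 4 * V" .
  moreover have "ennreal (u x) * indicator {x. \<exists>k. P k (grid_index b k x)} x \<le>
      (SUP N. ennreal (u x) * indicator (G N) x)" for x
  proof (cases "\<exists>k. P k (grid_index b k x)")
    case True
    then obtain k where "x \<in> A k" by (auto simp: A_def)
    then have "x \<in> G (nat k)" by (auto simp: G_def)
    then show ?thesis using True by (intro SUP_upper2[of "nat k"]) auto
  qed simp
  then have "(\<integral>\<^sup>+x\<in>{x. \<exists>k. P k (grid_index b k x)}. ennreal (u x) \<partial>lebesgue) \<le>
      (\<integral>\<^sup>+x. (SUP N. ennreal (u x) * indicator (G N) x) \<partial>lebesgue)"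
    by (rule nn_integral_mono)
  ultimately show ?thesis unfolding V_def by (rule order_trans[rotated])
qed

section \<open>Fractional averages on the grid: packing and comparison with the maximal
  function\<close>

definition grid_mass :: "nat \<Rightarrow> (real^'n \<Rightarrow> ennreal) \<Rightarrow> int \<Rightarrow> int^'n \<Rightarrow> ennreal" where
  "grid_mass b g k z = (\<integral>\<^sup>+y\<in>grid_nbhd b k z. g y \<partial>lebesgue)"

text \<open>Up to a constant, the side length to the power \<alpha> times the product of the
  averages over the triple; the powers are normalised by the side of the cell, not by that of the
  triple.\<close>

definition grid_frac ::
    "nat \<Rightarrow> real \<Rightarrow> nat \<Rightarrow> (nat \<Rightarrow> real^'n \<Rightarrow> ennreal) \<Rightarrow> int \<Rightarrow> int^'n \<Rightarrow> ennreal" where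
  "grid_frac b \<alpha> m g k z =
     ennreal (side b k powr (\<alpha> - real m * real CARD('n))) * (\<Prod>l<m. grid_mass b (g l) k z)"

text \<open>Tonelli's theorem and the symmetry of neighbourhoods: a point \<open>y\<close> enters
  only for those \<open>x\<close> in the triple of its own cell at scale \<open>j\<close>, a set of
  volume \<open>(3 * side b j) ^ CARD('n)\<close>, and nesting puts such a \<open>y\<close> into the
  triple at scale \<open>k\<close>.\<close>

lemma set_nn_integral_grid_mass_le:
  fixes g :: "real^'n \<Rightarrow> ennreal"
  assumes b: "0 < b" and jk: "j \<le> k" and [measurable]: "g \<in> borel_measurable lebesgue"
  shows "(\<integral>\<^sup>+x\<in>grid_cell b k z. grid_mass b g j (grid_index b j x) \<partial>lebesgue)
    \<le> ennreal ((3 * side b j) ^ CARD('n)) * grid_mass b g k z"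
proof -
  interpret pair_sigma_finite "lebesgue :: (real^'n) measure" "lebesgue :: (real^'n) measure" ..
  \<comment> \<open>The neighbour relation is written as a countable union of measurable rectangles,
    which makes the integrand jointly measurable.\<close>
  define R where "R = (\<Union>w::int^'n. grid_nbhd b j w \<times> grid_cell b j w)"
  have [measurable]: "R \<in> sets (lebesgue \<Otimes>\<^sub>M lebesgue)"
    unfolding R_def by (intro sets.countable_UN') auto
  have "(\<lambda>(x, y). g y * indicator (grid_nbhd b k z) y *
      indicator (grid_nbhd b j (grid_index b j y)) x) =
      (\<lambda>(x, y). g y * indicator (grid_nbhd b k z) y * indicator R (x, y))"
    by (auto simp: R_def indicator_def fun_eq_iff)
  also have "\<dots> \<in> borel_measurable (lebesgue \<Otimes>\<^sub>M lebesgue)"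
    by measurable
  finally have meas: "(\<lambda>(x, y). g y * indicator (grid_nbhd b k z) y *
      indicator (grid_nbhd b j (grid_index b j y)) x) \<in> borel_measurable (lebesgue \<Otimes>\<^sub>M lebesgue)" .
  have "(\<integral>\<^sup>+x\<in>grid_cell b k z. grid_mass b g j (grid_index b j x) \<partial>lebesgue) =
      (\<integral>\<^sup>+x. (\<integral>\<^sup>+y. g y * indicator (grid_nbhd b j (grid_index b j x)) y * indicator (grid_cell b k z) x
        \<partial>lebesgue) \<partial>lebesgue)"
    unfolding grid_mass_def by (intro nn_integral_cong nn_integral_multc[symmetric]) measurable
  also have "\<dots> \<le> (\<integral>\<^sup>+x. (\<integral>\<^sup>+y. g y * indicator (grid_nbhd b k z) y *
      indicator (grid_nbhd b j (grid_index b j y)) x \<partial>lebesgue) \<partial>lebesgue)"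
  proof (intro nn_integral_mono)
    fix x y
    show "g y * indicator (grid_nbhd b j (grid_index b j x)) y * indicator (grid_cell b k z) x
      \<le> g y * indicator (grid_nbhd b k z) y * indicator (grid_nbhd b j (grid_index b j y)) x"
      using grid_nbhd_coarsen[OF b jk, of x] grid_nbhd_sym[of y b j x]
      by (auto simp: indicator_def)
  qed
  also have "\<dots> = (\<integral>\<^sup>+y. (\<integral>\<^sup>+x. g y * indicator (grid_nbhd b k z) y *
      indicator (grid_nbhd b j (grid_index b j y)) x \<partial>lebesgue) \<partial>lebesgue)"
    by (rule Fubini'[symmetric, OF meas])
  also have "\<dots> = (\<integral>\<^sup>+y. ennreal ((3 * side b j) ^ CARD('n)) *
      (g y * indicator (grid_nbhd b k z) y) \<partial>lebesgue)"
    by (intro nn_integral_cong, subst nn_integral_cmult_indicator)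
      (simp_all only: sets_grid_nbhd emeasure_grid_nbhd[OF b] mult.commute)
  also have "\<dots> = ennreal ((3 * side b j) ^ CARD('n)) * grid_mass b g k z"
    by (simp add: nn_integral_cmult grid_mass_def)
  finally show ?thesis .
qed

text \<open>Chebyshev's inequality combined with the preceding integral bound. The mass of the
  coarse triple is positive and finite, hence cancels.\<close>

lemma emeasure_grid_mass_gt:
  fixes g :: "real^'n \<Rightarrow> ennreal"
  assumes b: "0 < b" and jk: "j \<le> k" and g [measurable]: "g \<in> borel_measurable lebesgue"
    and \<rho>: "0 < \<rho>" and M: "grid_mass b g k z \<noteq> 0" "grid_mass b g k z \<noteq> \<infinity>"
  shows "emeasure lebesgue
      {x \<in> grid_cell b k z. ennreal \<rho> * grid_mass b g k z < grid_mass b g j (grid_index b j x)}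
    \<le> ennreal ((3 * side b j) ^ CARD('n) / \<rho>)"
proof -
  obtain M where M': "grid_mass b g k z = ennreal M" "0 < M"
    using M by (cases "grid_mass b g k z") auto
  define c where "c = ennreal (1 / (\<rho> * M))"
  have *: "1 \<le> c * t" if "ennreal \<rho> * ennreal M < t" for t
  proof -
    have "1 = c * (ennreal \<rho> * ennreal M)"
      using \<rho> M' by (simp add: c_def ennreal_mult[symmetric])
    also have "\<dots> \<le> c * t" using that by (intro mult_left_mono) auto
    finally show ?thesis .
  qed
  have [measurable]: "(\<lambda>x. grid_mass b g j (grid_index b j x)) \<in> borel_measurable lebesgue"
    by measurable
  have S: "{x \<in> grid_cell b k z. 1 \<le> c * grid_mass b g j (grid_index b j x)} \<in> sets lebesgue"
  proof -
    have "{x \<in> space lebesgue. grid_index b k x = z \<and> 1 \<le> c * grid_mass b g j (grid_index b j x)} \<in> sets lebesgue"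
      by measurable
    then show ?thesis by simp
  qed
  have "emeasure lebesgue
      {x \<in> grid_cell b k z. ennreal \<rho> * grid_mass b g k z < grid_mass b g j (grid_index b j x)}
    \<le> emeasure lebesgue {x \<in> grid_cell b k z. 1 \<le> c * grid_mass b g j (grid_index b j x)}"
    using * M' by (intro emeasure_mono S) auto
  also have "\<dots> \<le> c * (\<integral>\<^sup>+x\<in>grid_cell b k z. grid_mass b g j (grid_index b j x) \<partial>lebesgue)"
    by (rule nn_integral_Markov_inequality) auto
  also have "\<dots> \<le> c * (ennreal ((3 * side b j) ^ CARD('n)) * ennreal M)"
    using set_nn_integral_grid_mass_le[OF b jk g, of z] M'(1) by (intro mult_left_mono) auto
  also have "\<dots> = ennreal ((3 * side b j) ^ CARD('n) / \<rho>)"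
    using \<rho> M' side_pos[OF b, of j] by (simp add: c_def ennreal_mult[symmetric])
  finally show ?thesis .
qed

text \<open>As \<open>0 * \<infinity> = 0\<close>, a finite product can hide infinite factors behind
  a zero one. A nonzero product excludes zero factors, and then finiteness excludes infinite
  ones.\<close>

lemma ennreal_prod_finite_factor:
  fixes h :: "'i \<Rightarrow> ennreal"
  assumes "finite I" "prod h I \<noteq> 0" "prod h I \<noteq> \<infinity>" "i \<in> I"
  shows "h i \<noteq> 0" "h i \<noteq> \<infinity>"
proof -
  have "prod h I = h i * prod h (I - {i})"
    using assms by (intro prod.remove)
  then show "h i \<noteq> 0" "h i \<noteq> \<infinity>"
    using assms(2,3) by (auto simp: ennreal_top_mult split: if_splits)
qed

text \<open>Passing to a cell \<open>i\<close> generations below lowers the power of the side length, so if the product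
  stays within a factor \<open>2\<close>, one of the \<open>m\<close> masses must be too large there; this is rare by
  Chebyshev's inequality, and the base \<open>b\<close> is chosen so as to beat all constants.\<close>

lemma packing_grid_frac:
  fixes g :: "nat \<Rightarrow> real^'n \<Rightarrow> ennreal"
  assumes m: "1 \<le> m" and \<alpha>: "0 < \<alpha>" and t: "0 < t"
    and b: "0 < b" "16 * real m * 3 ^ CARD('n) \<le> real b powr (\<alpha> / real m)"
    and g [measurable]: "\<And>l. l < m \<Longrightarrow> g l \<in> borel_measurable lebesgue"
    and P: "\<And>k z. P k z \<longleftrightarrow> ennreal t < grid_frac b \<alpha> m g k z \<and> grid_frac b \<alpha> m g k z \<le> ennreal (2 * t)"
    and z: "P k z" and i: "1 \<le> i"
  shows "emeasure lebesgue {x \<in> grid_cell b k z. P (k - int i) (grid_index b (k - int i) x)}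
    \<le> ennreal ((1/8) ^ i) * emeasure lebesgue (grid_cell b k z)"
proof -
  define n where "n = CARD('n)"
  define e where "e = \<alpha> - real m * real n"
  define j where "j = k - int i"
  \<comment> \<open>The factor is fixed by
    \<open>side b j powr e * \<rho> ^ m = (1/2) ^ m * side b k powr e\<close>: if no mass exceeds
    \<rho> times the coarse one, the fractional average at the finer scale is at most
    \<open>2 * t / 2 ^ m\<close>, hence not above \<open>t\<close>.\<close>
  define \<rho> where "\<rho> = 1/2 * real b powr (real i * e / real m)"
  have b0: "0 < real b" using b by simp
  have s: "0 < side b k" "0 < side b j" using b by (simp_all add: side_pos)
  have \<rho>: "0 < \<rho>" using b by (simp add: \<rho>_def)
  define M where "M l = grid_mass b (g l) k z" for l
  have frac: "grid_frac b \<alpha> m g k z = ennreal (side b k powr e) * (\<Prod>l<m. M l)"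
    by (simp add: grid_frac_def e_def n_def M_def)
  have "(\<Prod>l<m. M l) \<noteq> 0"
    using z unfolding P frac by (metis mult_zero_right not_less_zero)
  moreover have "(\<Prod>l<m. M l) \<noteq> \<infinity>"
  proof
    assume top: "(\<Prod>l<m. M l) = \<infinity>"
    show False
      using z s unfolding P frac top by (auto simp: ennreal_mult_top top_unique)
  qed
  ultimately have M: "M l \<noteq> 0" "M l \<noteq> \<infinity>" if "l < m" for l
    using ennreal_prod_finite_factor[of "{..<m}" M l] that by auto
  have pigeonhole: "\<exists>l<m. ennreal \<rho> * M l < grid_mass b (g l) j w" if w: "P j w" for w
  proof (rule ccontr)
    assume "\<not> ?thesis"
    then have le: "\<And>l. l < m \<Longrightarrow> grid_mass b (g l) j w \<le> ennreal \<rho> * M l"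
      by (meson linorder_not_le)
    have "side b j powr e = side b k powr e * real b powr (- real i * e)"
      using b0 by (simp add: side_def j_def powr_powr powr_add[symmetric] algebra_simps)
    moreover have "\<rho> ^ m = (1/2) ^ m * real b powr (real i * e)"
    proof -
      have "(real b powr (real i * e / real m)) ^ m = real b powr (real i * e)"
        using m b0 by (simp add: powr_realpow[symmetric] powr_powr)
      then show ?thesis unfolding \<rho>_def power_mult_distrib by simp
    qed
    ultimately have c: "side b j powr e * \<rho> ^ m = (1/2) ^ m * side b k powr e"
      using b0 by (simp add: powr_minus)
    have "grid_frac b \<alpha> m g j w = ennreal (side b j powr e) * (\<Prod>l<m. grid_mass b (g l) j w)"
      by (simp add: grid_frac_def e_def n_def)
    also have "\<dots> \<le> ennreal (side b j powr e) * (\<Prod>l<m. ennreal \<rho> * M l)"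
      using le by (intro mult_left_mono prod_mono_ennreal) auto
    also have "\<dots> = ennreal (side b j powr e * \<rho> ^ m) * (\<Prod>l<m. M l)"
      using \<rho> by (simp add: prod.distrib ennreal_mult ennreal_power mult.assoc)
    also have "\<dots> = ennreal ((1/2) ^ m) * grid_frac b \<alpha> m g k z"
      unfolding c frac by (simp add: ennreal_mult mult.assoc)
    also have "\<dots> \<le> ennreal (1/2) * ennreal (2 * t)"
      using z m power_decreasing[of 1 m "1/2 :: real"] unfolding P by (intro mult_mono ennreal_leI) auto
    also have "\<dots> = ennreal t" using t by (subst ennreal_mult[symmetric]) simp_all
    finally show False using w unfolding P by (meson linorder_not_le)
  qed
  define S where "S l = {x \<in> grid_cell b k z. ennreal \<rho> * grid_mass b (g l) k z < grid_mass b (g l) j (grid_index b j x)}" for l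
  have [measurable]: "S l \<in> sets lebesgue" for l
  proof -
    have "{x \<in> space lebesgue. grid_index b k x = z \<and>
        ennreal \<rho> * grid_mass b (g l) k z < grid_mass b (g l) j (grid_index b j x)} \<in> sets lebesgue"
      by measurable
    then show ?thesis by (simp add: S_def)
  qed
  have "{x \<in> grid_cell b k z. P j (grid_index b j x)} \<subseteq> (\<Union>l\<in>{..<m}. S l)"
  proof
    fix x assume x: "x \<in> {x \<in> grid_cell b k z. P j (grid_index b j x)}"
    then obtain l where "l < m" "ennreal \<rho> * M l < grid_mass b (g l) j (grid_index b j x)"
      using pigeonhole by blast
    then show "x \<in> (\<Union>l\<in>{..<m}. S l)"
      using x by (auto simp: S_def M_def)
  qed
  then have "emeasure lebesgue {x \<in> grid_cell b k z. P j (grid_index b j x)} \<le> emeasure lebesgue (\<Union>l\<in>{..<m}. S l)"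
    by (intro emeasure_mono) auto
  also have "\<dots> \<le> (\<Sum>l\<in>{..<m}. emeasure lebesgue (S l))"
    by (intro emeasure_subadditive_finite) auto
  also have "\<dots> \<le> (\<Sum>l\<in>{..<m}. ennreal ((3 * side b j) ^ n / \<rho>))"
  proof (rule sum_mono)
    fix l assume "l \<in> {..<m}"
    then show "emeasure lebesgue (S l) \<le> ennreal ((3 * side b j) ^ n / \<rho>)"
      unfolding S_def n_def using M[of l] g[of l] \<rho> b(1)
      by (intro emeasure_grid_mass_gt) (auto simp: j_def M_def)
  qed
  also have "\<dots> = ennreal (real m * ((3 * side b j) ^ n / \<rho>))"
    using \<rho> s by (subst ennreal_mult) (simp_all add: ennreal_of_nat_eq_real_of_nat)
  also have "\<dots> \<le> ennreal ((1/8) ^ i * side b k ^ n)"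
  proof (rule ennreal_leI)
    \<comment> \<open>The volume ratio cancels the dimensional part of \<rho>, which leaves
      \<open>2 / \<theta> ^ i\<close>. One factor \<theta> absorbs all constants and one factor
      \<open>8\<close>; each of the others is at least \<open>8\<close>.\<close>
    define \<theta> where "\<theta> = real b powr (\<alpha> / real m)"
    have \<theta>: "16 * real m * 3 ^ n \<le> \<theta>" "0 < \<theta>" using b b0 by (simp_all add: \<theta>_def n_def)
    have "side b j ^ n / \<rho> = 2 * side b k ^ n / \<theta> ^ i"
    proof -
      have "real i * e / real m = real i * \<alpha> / real m - real i * real n"
        using m by (simp add: e_def field_simps)
      then have "\<rho> = 1/2 * (\<theta> ^ i / real b powr (real i * real n))"
        using b0 by (simp add: \<rho>_def \<theta>_def powr_diff powr_realpow[symmetric] powr_powr mult.commute del: powr_realpow)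
      moreover have "side b j ^ n = side b k ^ n / real b powr (real i * real n)"
        using b0 by (simp add: side_def j_def powr_diff power_divide powr_realpow[symmetric] powr_powr del: powr_realpow)
      ultimately show ?thesis using b0 \<theta> by simp
    qed
    moreover have "real m * ((3 * side b j) ^ n / \<rho>) = real m * 3 ^ n * (side b j ^ n / \<rho>)"
      by (simp add: power_mult_distrib)
    ultimately have "real m * ((3 * side b j) ^ n / \<rho>) = side b k ^ n * (2 * real m * 3 ^ n / \<theta> ^ i)"
      by simp
    also have "\<dots> \<le> side b k ^ n * (1/8) ^ i"
    proof (rule mult_left_mono)
      obtain i' where i': "i = Suc i'" using i by (cases i) auto
      have "1 * 1 \<le> real m * 3 ^ n" using m by (intro mult_mono) auto
      then have "8 \<le> \<theta>" using \<theta> by simp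
      then have "8 ^ i' \<le> \<theta> ^ i'" by (intro power_mono) auto
      then have "(16 * real m * 3 ^ n) * 8 ^ i' \<le> \<theta> * \<theta> ^ i'"
        using \<theta> by (intro mult_mono) auto
      then show "2 * real m * 3 ^ n / \<theta> ^ i \<le> (1/8) ^ i"
        using \<theta> by (simp add: i' power_divide field_simps)
    qed (use s in simp)
    finally show "real m * ((3 * side b j) ^ n / \<rho>) \<le> (1/8) ^ i * side b k ^ n"
      by (simp add: mult.commute)
  qed
  also have "\<dots> = ennreal ((1/8) ^ i) * emeasure lebesgue (grid_cell b k z)"
    unfolding emeasure_grid_cell[OF b(1)] n_def using s by (simp add: ennreal_mult)
  finally show ?thesis by (simp add: j_def)
qed

text \<open>The closed triple contains \<open>x\<close> and so is admissible in the supremum. The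
  power of \<open>3\<close> converts the side of the cell into that of the triple.\<close>

lemma grid_frac_le_frac_maximal:
  fixes f :: "nat \<Rightarrow> real^'n \<Rightarrow> complex"
  assumes b: "0 < b"
  shows "ennreal (3 powr (\<alpha> - real m * real CARD('n))) *
      grid_frac b \<alpha> m (\<lambda>l y. ennreal (norm (f l y))) k (grid_index b k x) \<le> frac_maximal \<alpha> m f x"
proof -
  define n where "n = CARD('n)"
  have n: "0 < n" by (simp add: n_def)
  define s where "s = 3 * side b k"
  have s: "0 < s" using side_pos[OF b] by (simp add: s_def)
  define z where "z = grid_index b k x"
  define Q where "Q = (grid_cube3 b k z :: (real^'n) set)"
  define M where "M l = grid_mass b (\<lambda>y. ennreal (norm (f l y))) k z" for l
  have Qn: "emeasure lebesgue Q = ennreal (s ^ n)"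
    unfolding Q_def s_def n_def by (rule emeasure_grid_cube3[OF b])
  have x: "x \<in> Q"
    unfolding Q_def by (rule subsetD[OF grid_nbhd_subset_cube3[OF b]]) (simp add: grid_nbhd_def z_def)
  have av: "ennreal (1 / s ^ n) * M l \<le> average Q (\<lambda>y. ennreal (norm (f l y)))" for l
  proof -
    have "M l \<le> (\<integral>\<^sup>+y\<in>Q. ennreal (norm (f l y)) \<partial>lebesgue)"
      unfolding M_def grid_mass_def Q_def using grid_nbhd_subset_cube3[OF b, of k z]
      by (intro nn_integral_mono) (auto simp: indicator_def)
    then have "M l / ennreal (s ^ n) \<le> average Q (\<lambda>y. ennreal (norm (f l y)))"
      unfolding average_def Qn by (rule divide_right_mono_ennreal)
    moreover have "M l / ennreal (s ^ n) = ennreal (1 / s ^ n) * M l"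
      using s by (simp add: divide_ennreal_def inverse_ennreal mult.commute inverse_eq_divide)
    ultimately show ?thesis by simp
  qed
  have pow: "(s ^ n) powr (\<alpha> / real n) = s powr \<alpha>"
    using s n by (simp add: powr_realpow[symmetric] powr_powr)
  have c: "s powr \<alpha> * (1 / s ^ n) ^ m = 3 powr (\<alpha> - real m * real n) * side b k powr (\<alpha> - real m * real n)"
  proof -
    have "(1 / s ^ n) ^ m = s powr (- (real m * real n))"
    proof -
      have "s powr (real m * real n) = (s ^ n) ^ m"
        using s powr_realpow[of s "n * m"] by (simp add: power_mult[symmetric] mult.commute)
      then show ?thesis by (simp add: powr_minus divide_inverse power_inverse)
    qed
    then have "s powr \<alpha> * (1 / s ^ n) ^ m = s powr (\<alpha> - real m * real n)"
      by (simp add: powr_add[symmetric])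
    then show ?thesis using side_pos[OF b, of k] by (simp add: s_def powr_mult)
  qed
  have "ennreal (3 powr (\<alpha> - real m * real n)) *
      grid_frac b \<alpha> m (\<lambda>l y. ennreal (norm (f l y))) k z =
      ennreal (s powr \<alpha> * (1 / s ^ n) ^ m) * (\<Prod>l<m. M l)"
    unfolding c by (simp add: grid_frac_def n_def M_def ennreal_mult mult.assoc)
  also have "\<dots> = ennreal (s powr \<alpha>) * (\<Prod>l<m. ennreal (1 / s ^ n) * M l)"
    using s by (subst ennreal_mult) (simp_all add: prod.distrib ennreal_power mult.assoc)
  also have "\<dots> \<le> ennreal (s powr \<alpha>) * (\<Prod>l<m. average Q (\<lambda>y. ennreal (norm (f l y))))"
    by (intro mult_left_mono prod_mono_ennreal av) auto
  also have "\<dots> = ennreal (measure lebesgue Q powr (\<alpha> / real n)) *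
      (\<Prod>l<m. average Q (\<lambda>y. ennreal (norm (f l y))))"
    using Qn s by (simp add: measure_def pow)
  also have "\<dots> \<le> frac_maximal \<alpha> m f x"
    unfolding frac_maximal_def n_def using x cube_grid_cube3[OF b, of k z]
    by (intro SUP_upper) (auto simp: Q_def)
  finally show ?thesis by (simp add: n_def z_def)
qed

section \<open>Domination of the fractional integral by a sum over scales\<close>

lemma ex_side_bracket:
  assumes b: "2 \<le> b" and S: "0 < S"
  obtains k where "side b (k - 1) \<le> S" "S < side b k"
proof
  let ?k = "\<lfloor>log (real b) S\<rfloor> + 1"
  have b1: "1 < real b" using b by simp
  have "real b powr real_of_int (?k - 1) \<le> real b powr log (real b) S"
    using b1 by (intro powr_mono) auto
  then show "side b (?k - 1) \<le> S" using b1 S by (simp add: side_def)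
  have "real b powr log (real b) S < real b powr real_of_int ?k"
    using b1 by (intro powr_less_mono) linarith+
  then show "S < side b ?k" using b1 S by (simp add: side_def)
qed

text \<open>Unless it vanishes, the sum of the distances lies between two consecutive side lengths.
  At the upper scale every \<open>y l\<close> is in the triple around \<open>x\<close>, so this one
  term of the sum over \<open>k\<close> suffices; replacing the lower side length by the upper one
  costs the power of \<open>b\<close>.\<close>

lemma norm_frac_integrand_le:
  fixes f :: "nat \<Rightarrow> real^'n \<Rightarrow> complex"
  assumes b: "2 \<le> b" and \<alpha>: "\<alpha> < real m * real CARD('n)"
  shows "ennreal (norm (frac_integrand \<alpha> m f x y)) \<le>
    ennreal (real b powr (real m * real CARD('n) - \<alpha>)) *
    (\<integral>\<^sup>+k. ennreal (side b k powr (\<alpha> - real m * real CARD('n))) *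
      (\<Prod>l<m. ennreal (norm (f l (y l))) * indicator (grid_nbhd b k (grid_index b k x)) (y l))
      \<partial>count_space UNIV)"
proof -
  define e where "e = real m * real CARD('n) - \<alpha>"
  have e: "0 < e" using \<alpha> by (simp add: e_def)
  define S where "S = (\<Sum>i<m. norm (x - y i))"
  have S0: "0 \<le> S" by (simp add: S_def sum_nonneg)
  have norm: "norm (frac_integrand \<alpha> m f x y) = (\<Prod>l<m. norm (f l (y l))) / S powr e"
    by (simp add: frac_integrand_def norm_divide prod_norm S_def e_def)
  show ?thesis
  proof (cases "S = 0")
    \<comment> \<open>Here the denominator vanishes, and division by zero makes the integrand
      \<open>0\<close>.\<close>
    case True
    then show ?thesis using norm by simp
  next
    case False
    then have "0 < S" using S0 by simp
    then obtain k where k: "side b (k - 1) \<le> S" "S < side b k"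
      using ex_side_bracket[OF b] by metis
    have b0: "0 < b" using b by simp
    have s: "0 < side b (k - 1)" "0 < side b k" using side_pos[OF b0] by auto
    have nb: "y l \<in> grid_nbhd b k (grid_index b k x)" if "l < m" for l
    proof (rule grid_nbhdI_norm[OF b0])
      have "norm (x - y l) \<le> S"
        unfolding S_def using that by (intro member_le_sum) auto
      then show "norm (x - y l) < side b k" using k by simp
    qed
    have "side b k = real b * side b (k - 1)"
      using b0 by (simp add: side_def powr_diff)
    then have pw: "1 / side b (k - 1) powr e = real b powr e * side b k powr (- e)"
      using s b0 by (simp add: powr_mult powr_minus field_simps)
    have "norm (frac_integrand \<alpha> m f x y) \<le> (\<Prod>l<m. norm (f l (y l))) / side b (k - 1) powr e"
      unfolding norm using k s e
      by (intro divide_left_mono powr_mono2 prod_nonneg mult_pos_pos) auto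
    also have "\<dots> = real b powr e * (side b k powr (- e) * (\<Prod>l<m. norm (f l (y l))))"
      using pw by (simp add: divide_inverse mult_ac)
    finally have "ennreal (norm (frac_integrand \<alpha> m f x y)) \<le>
        ennreal (real b powr e * (side b k powr (- e) * (\<Prod>l<m. norm (f l (y l)))))"
      by (rule ennreal_leI)
    also have "\<dots> = ennreal (real b powr e) * (ennreal (side b k powr (- e)) *
        (\<Prod>l<m. ennreal (norm (f l (y l)))))"
      by (simp add: ennreal_mult prod_nonneg prod_ennreal)
    also have "(\<Prod>l<m. ennreal (norm (f l (y l)))) =
        (\<Prod>l<m. ennreal (norm (f l (y l))) * indicator (grid_nbhd b k (grid_index b k x)) (y l))"
      using nb by (intro prod.cong) auto
    also have "ennreal (side b k powr (- e)) * \<dots> \<le>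
        (\<integral>\<^sup>+k. ennreal (side b k powr (- e)) *
          (\<Prod>l<m. ennreal (norm (f l (y l))) * indicator (grid_nbhd b k (grid_index b k x)) (y l))
          \<partial>count_space UNIV)"
      by (rule nn_integral_ge_point[of k UNIV]) simp
    finally show ?thesis by (simp add: e_def mult_left_mono)
  qed
qed

text \<open>The pointwise bound is integrated: at each scale its integrand is a product of functions
  of single variables, so the integral over the product space factors into the masses.\<close>

lemma norm_frac_integral_le:
  fixes f :: "nat \<Rightarrow> real^'n \<Rightarrow> complex"
  assumes b: "2 \<le> b" and \<alpha>: "\<alpha> < real m * real CARD('n)"
    and f: "\<And>i. i < m \<Longrightarrow> f i \<in> borel_measurable lebesgue"
  shows "ennreal (norm (frac_integral \<alpha> m f x)) \<le>
    ennreal (real b powr (real m * real CARD('n) - \<alpha>)) *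
    (\<integral>\<^sup>+k. grid_frac b \<alpha> m (\<lambda>l y. ennreal (norm (f l y))) k (grid_index b k x) \<partial>count_space UNIV)"
proof (cases "integrable (\<Pi>\<^sub>M i\<in>{..<m}. lebesgue) (frac_integrand \<alpha> m f x)")
  case True
  interpret product_sigma_finite "\<lambda>_::nat. lebesgue :: (real^'n) measure" ..
  define h where "h k l = (\<lambda>v. ennreal (norm (f l v)) * indicator (grid_nbhd b k (grid_index b k x)) v)" for k l
  have h: "h k l \<in> borel_measurable lebesgue" if "l < m" for k l
    unfolding h_def using f[OF that] by measurable
  have [measurable]: "(\<lambda>y. \<Prod>l<m. h k l (y l)) \<in> borel_measurable (\<Pi>\<^sub>M i\<in>{..<m}. lebesgue)" for k
  proof (rule borel_measurable_prod_ennreal)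
    fix l assume "l \<in> {..<m}"
    then show "(\<lambda>y. h k l (y l)) \<in> borel_measurable (\<Pi>\<^sub>M i\<in>{..<m}. lebesgue)"
      using h[of l k] by (intro measurable_compose[OF measurable_component_singleton]) auto
  qed
  define C where "C = real b powr (real m * real CARD('n) - \<alpha>)"
  have "ennreal (norm (frac_integral \<alpha> m f x)) \<le>
      (\<integral>\<^sup>+y. ennreal (norm (frac_integrand \<alpha> m f x y)) \<partial>(\<Pi>\<^sub>M i\<in>{..<m}. lebesgue))"
    unfolding frac_integral_def using True by (rule integral_norm_bound_ennreal)
  also have "\<dots> \<le> (\<integral>\<^sup>+y. (\<integral>\<^sup>+k. ennreal C * (ennreal (side b k powr (\<alpha> - real m * real CARD('n))) *
      (\<Prod>l<m. h k l (y l))) \<partial>count_space UNIV) \<partial>(\<Pi>\<^sub>M i\<in>{..<m}. lebesgue))"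
    using norm_frac_integrand_le[OF b \<alpha>, of f x]
    by (intro nn_integral_mono) (simp add: h_def C_def nn_integral_cmult)
  also have "\<dots> = (\<integral>\<^sup>+k. (\<integral>\<^sup>+y. ennreal C * (ennreal (side b k powr (\<alpha> - real m * real CARD('n))) *
      (\<Prod>l<m. h k l (y l))) \<partial>(\<Pi>\<^sub>M i\<in>{..<m}. lebesgue)) \<partial>count_space UNIV)"
    by (rule nn_integral_count_space_nn_integral) auto
  also have "\<dots> = (\<integral>\<^sup>+k. ennreal C *
      grid_frac b \<alpha> m (\<lambda>l y. ennreal (norm (f l y))) k (grid_index b k x) \<partial>count_space UNIV)"
  proof (rule nn_integral_cong)
    fix k
    have "(\<integral>\<^sup>+y. (\<Prod>l<m. h k l (y l)) \<partial>(\<Pi>\<^sub>M i\<in>{..<m}. lebesgue)) = (\<Prod>l<m. integral\<^sup>N lebesgue (h k l))"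
      using h by (intro product_nn_integral_prod) auto
    also have "\<dots> = (\<Prod>l<m. grid_mass b (\<lambda>y. ennreal (norm (f l y))) k (grid_index b k x))"
      by (simp add: h_def grid_mass_def)
    finally show "(\<integral>\<^sup>+y. ennreal C * (ennreal (side b k powr (\<alpha> - real m * real CARD('n))) *
      (\<Prod>l<m. h k l (y l))) \<partial>(\<Pi>\<^sub>M i\<in>{..<m}. lebesgue)) =
      ennreal C * grid_frac b \<alpha> m (\<lambda>l y. ennreal (norm (f l y))) k (grid_index b k x)"
      unfolding grid_frac_def by (simp add: nn_integral_cmult)
  qed
  finally show ?thesis by (simp add: nn_integral_cmult C_def)
next
  \<comment> \<open>At such a point the Bochner integral is \<open>0\<close> by convention.\<close>
  case False
  then show ?thesis by (simp add: frac_integral_def not_integrable_integral_eq)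
qed

section \<open>Dyadic levels and exceptional sets\<close>

lemma nth_le_suminf_ennreal: "f j \<le> (\<Sum>i. f i)" for f :: "nat \<Rightarrow> ennreal"
  using sum_le_suminf[of f "{j}"] by simp

text \<open>All terms are at most \<tau>, so every nonzero one lies in a dyadic level between
  \<open>\<tau> / 2 ^ Suc j\<close> and \<open>\<tau> / 2 ^ j\<close>. Level \<open>j\<close> has
  fewer than \<open>2 * s j\<close> terms, each at most its upper end.\<close>

lemma sum_le_of_level_counts:
  fixes a :: "int \<Rightarrow> ennreal"
  assumes \<tau>: "0 < \<tau>" and top: "\<And>k. a k \<le> ennreal \<tau>"
    and level: "\<And>j. finite {k. ennreal (\<tau> * (1/2) ^ Suc j) < a k \<and> a k \<le> ennreal (2 * (\<tau> * (1/2) ^ Suc j))} \<and>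
      card {k. ennreal (\<tau> * (1/2) ^ Suc j) < a k \<and> a k \<le> ennreal (2 * (\<tau> * (1/2) ^ Suc j))} < 2 * s j"
  shows "(\<integral>\<^sup>+k. a k \<partial>count_space UNIV) \<le> (\<Sum>j. ennreal (\<tau> * (1/2) ^ j * (2 * real (s j))))"
proof -
  define K where "K j = {k. ennreal (\<tau> * (1/2) ^ Suc j) < a k \<and> a k \<le> ennreal (2 * (\<tau> * (1/2) ^ Suc j))}" for j
  have cover: "\<exists>j. k \<in> K j" if nz: "a k \<noteq> 0" for k
  proof -
    obtain r where r: "a k = ennreal r" "0 < r" "r \<le> \<tau>"
      using top[of k] nz \<tau> by (cases "a k") (auto simp: top_unique order_less_le)
    have "\<exists>j. (1/2 :: real) ^ j < r / \<tau>"
      using r \<tau> by (intro real_arch_pow_inv) auto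
    then have ex: "\<exists>j. \<tau> * (1/2) ^ j < r" using \<tau> by (simp add: field_simps)
    \<comment> \<open>The level sought is the predecessor of this least \<open>j\<close>; it exists
      because \<open>r \<le> \<tau>\<close> rules out \<open>j = 0\<close>.\<close>
    define j where "j = (LEAST j. \<tau> * (1/2) ^ j < r)"
    have j: "\<tau> * (1/2) ^ j < r" unfolding j_def using ex by (rule LeastI_ex)
    then have "j \<noteq> 0" using r by (intro notI) simp
    then obtain i where i: "j = Suc i" by (cases j) auto
    have "\<not> \<tau> * (1/2) ^ i < r"
      using not_less_Least[of i "\<lambda>j. \<tau> * (1/2) ^ j < r"] i by (simp add: j_def)
    then have "k \<in> K i"
      using j i r \<tau> by (auto simp: K_def ennreal_less_iff ennreal_le_iff)
    then show ?thesis ..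
  qed
  have "(\<integral>\<^sup>+k. a k \<partial>count_space UNIV) \<le>
      (\<integral>\<^sup>+k. (\<Sum>j. ennreal (\<tau> * (1/2) ^ j) * indicator (K j) k) \<partial>count_space UNIV)"
  proof (rule nn_integral_mono)
    fix k
    show "a k \<le> (\<Sum>j. ennreal (\<tau> * (1/2) ^ j) * indicator (K j) k)"
    proof (cases "a k = 0")
      case False
      then obtain j where j: "k \<in> K j" using cover by blast
      then have "a k \<le> ennreal (\<tau> * (1/2) ^ j) * indicator (K j) k"
        by (simp add: K_def)
      also have "\<dots> \<le> (\<Sum>j. ennreal (\<tau> * (1/2) ^ j) * indicator (K j) k)"
        by (rule nth_le_suminf_ennreal)
      finally show ?thesis .
    qed simp
  qed
  also have "\<dots> = (\<Sum>j. (\<integral>\<^sup>+k. ennreal (\<tau> * (1/2) ^ j) * indicator (K j) k \<partial>count_space UNIV))"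
    by (rule nn_integral_suminf) auto
  also have "\<dots> \<le> (\<Sum>j. ennreal (\<tau> * (1/2) ^ j * (2 * real (s j))))"
  proof (rule suminf_le)
    fix j
    have K: "finite (K j)" "card (K j) < 2 * s j" using level[of j] by (simp_all add: K_def)
    have "(\<integral>\<^sup>+k. ennreal (\<tau> * (1/2) ^ j) * indicator (K j) k \<partial>count_space UNIV) =
        ennreal (\<tau> * (1/2) ^ j * real (card (K j)))"
      using K \<tau> by (simp add: nn_integral_cmult ennreal_mult ennreal_of_nat_eq_real_of_nat)
    also have "\<dots> \<le> ennreal (\<tau> * (1/2) ^ j * (2 * real (s j)))"
      using K \<tau> by (intro ennreal_leI mult_left_mono) auto
    finally show "(\<integral>\<^sup>+k. ennreal (\<tau> * (1/2) ^ j) * indicator (K j) k \<partial>count_space UNIV)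
      \<le> ennreal (\<tau> * (1/2) ^ j * (2 * real (s j)))" .
  qed auto
  finally show ?thesis .
qed

text \<open>A point where all terms are at most \<tau> and every level obeys its count cannot lie in
  \<open>E\<close>. So \<open>E\<close> is covered by \<open>G\<close>, where some term exceeds
  \<tau>, and by the exceptional sets \<open>H j\<close> of the levels; their weights give the two
  summands.\<close>

lemma weighted_measure_grid_sum_gt:
  fixes u :: "real^'n \<Rightarrow> real" and g :: "nat \<Rightarrow> real^'n \<Rightarrow> ennreal"
  assumes u: "weight u" and \<delta>: "0 < \<delta>" and m: "1 \<le> m" and \<alpha>: "0 < \<alpha>" and \<tau>: "0 < \<tau>"
    and b: "0 < b" "16 * real m * 3 ^ CARD('n) \<le> real b powr (\<alpha> / real m)"
    and g: "\<And>l. l < m \<Longrightarrow> g l \<in> borel_measurable lebesgue"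
    and s: "\<And>j. 1 \<le> s j"
    and \<Omega>: "\<And>t k x. 0 < t \<Longrightarrow> ennreal t < grid_frac b \<alpha> m g k (grid_index b k x) \<Longrightarrow> x \<in> \<Omega> t"
    and E: "\<And>x. x \<in> E \<Longrightarrow> (\<Sum>j. ennreal (\<tau> * (1/2) ^ j * (2 * real (s j))))
      < (\<integral>\<^sup>+k. grid_frac b \<alpha> m g k (grid_index b k x) \<partial>count_space UNIV)"
  shows "weighted_measure (\<lambda>x. ennreal (u x)) E \<le>
    4 * weighted_measure (orlicz_maximal (LlogL \<delta>) u) (\<Omega> \<tau>) +
    (\<Sum>j. ennreal (2 * (2 * (1/4) ^ s j + (1 + real (s j) * ln 2) powr (-\<delta>)) / real (s j)) *
      weighted_measure (orlicz_maximal (LlogL \<delta>) u) (\<Omega> (\<tau> * (1/2) ^ Suc j)))"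
proof -
  have [measurable]: "u \<in> borel_measurable lebesgue"
    using u by (auto simp: weight_def)
  define V where "V t = weighted_measure (orlicz_maximal (LlogL \<delta>) u) (\<Omega> t)" for t
  define \<kappa> where "\<kappa> j = ennreal (2 * (2 * (1/4) ^ s j + (1 + real (s j) * ln 2) powr (-\<delta>)) / real (s j))" for j
  \<comment> \<open>Twice \<open>t 0\<close> is \<tau>, so the levels end exactly where
    \<open>G\<close> takes over.\<close>
  define t where "t j = \<tau> * (1/2) ^ Suc j" for j
  have t: "0 < t j" for j using \<tau> by (simp add: t_def)
  define a where "a k x = grid_frac b \<alpha> m g k (grid_index b k x)" for k x
  define good where "good j H \<longleftrightarrow> H \<in> sets lebesgue \<and>
    (\<forall>x. x \<notin> H \<longrightarrow> finite {k. ennreal (t j) < a k x \<and> a k x \<le> ennreal (2 * t j)} \<and>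
      card {k. ennreal (t j) < a k x \<and> a k x \<le> ennreal (2 * t j)} < 2 * s j) \<and>
    (\<integral>\<^sup>+x\<in>H. ennreal (u x) \<partial>lebesgue) \<le> \<kappa> j * V (t j)" for j H
  have "\<exists>H. good j H" for j
  proof -
    let ?P = "\<lambda>k z. ennreal (t j) < grid_frac b \<alpha> m g k z \<and> grid_frac b \<alpha> m g k z \<le> ennreal (2 * t j)"
    show ?thesis
    proof (rule weak_overlap_bound[OF u \<delta> b(1) s[of j], where P = ?P and \<Omega> = "\<Omega> (t j)"])
      fix k :: int and i :: nat and z :: "int^'n" assume kz: "?P k z" and i: "1 \<le> i"
      show "emeasure lebesgue {x \<in> grid_cell b k z. ?P (k - int i) (grid_index b (k - int i) x)}
        \<le> ennreal ((1/8) ^ i) * emeasure lebesgue (grid_cell b k z)"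
        by (rule packing_grid_frac[where P = ?P, OF m \<alpha> t[of j] b]) (rule g kz i refl | assumption)+
    next
      fix x k assume "?P k (grid_index b k x)"
      then show "x \<in> \<Omega> (t j)" by (intro \<Omega>[OF t, of j k]) (rule conjunct1)
    next
      fix H assume H: "H \<in> sets lebesgue"
        "\<And>x. x \<notin> H \<Longrightarrow> finite {k. ?P k (grid_index b k x)} \<and> card {k. ?P k (grid_index b k x)} < 2 * s j"
        "(\<integral>\<^sup>+x\<in>H. ennreal (u x) \<partial>lebesgue)
          \<le> ennreal (2 * (2 * (1/4) ^ s j + (1 + real (s j) * ln 2) powr (-\<delta>)) / real (s j)) *
            (\<integral>\<^sup>+x\<in>\<Omega> (t j). orlicz_maximal (LlogL \<delta>) u x \<partial>lebesgue)"
      show ?thesis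
        unfolding good_def a_def \<kappa>_def V_def weighted_measure_def
        by (intro exI[of _ H] conjI[OF H(1)] conjI[OF _ H(3)] allI impI H(2))
    qed
  qed
  then obtain H where good: "\<And>j. good j (H j)"
    by metis
  have H: "H j \<in> sets lebesgue"
    "x \<notin> H j \<Longrightarrow> finite {k. ennreal (t j) < a k x \<and> a k x \<le> ennreal (2 * t j)} \<and>
      card {k. ennreal (t j) < a k x \<and> a k x \<le> ennreal (2 * t j)} < 2 * s j"
    "(\<integral>\<^sup>+x\<in>H j. ennreal (u x) \<partial>lebesgue) \<le> \<kappa> j * V (t j)" for j x
    using good[of j] unfolding good_def by blast+
  note [measurable] = H(1)
  define G where "G = {x. \<exists>k. ennreal \<tau> < a k x}"
  have [measurable]: "G \<in> sets lebesgue"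
  proof -
    have "G = (\<Union>k. {x. ennreal \<tau> < grid_frac b \<alpha> m g k (grid_index b k x)})"
      by (auto simp: G_def a_def)
    then show ?thesis by (auto intro!: sets.countable_UN' sets_grid_index)
  qed
  have E_sub: "x \<in> G \<or> (\<exists>j. x \<in> H j)" if "x \<in> E" for x
  proof (rule ccontr)
    assume "\<not> ?thesis"
    then have nG: "\<And>k. a k x \<le> ennreal \<tau>" and nH: "\<And>j. x \<notin> H j"
      unfolding G_def mem_Collect_eq by (meson linorder_not_le)+
    have "(\<integral>\<^sup>+k. a k x \<partial>count_space UNIV) \<le> (\<Sum>j. ennreal (\<tau> * (1/2) ^ j * (2 * real (s j))))"
      by (rule sum_le_of_level_counts[OF \<tau> nG, OF H(2)[OF nH, unfolded t_def]])
    then show False using E[OF that] unfolding a_def by (meson linorder_not_le)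
  qed
  have "weighted_measure (\<lambda>x. ennreal (u x)) E \<le>
      (\<integral>\<^sup>+x. ennreal (u x) * indicator G x + (\<Sum>j. ennreal (u x) * indicator (H j) x) \<partial>lebesgue)"
    unfolding weighted_measure_def
  proof (rule nn_integral_mono)
    fix x
    show "ennreal (u x) * indicator E x \<le>
        ennreal (u x) * indicator G x + (\<Sum>j. ennreal (u x) * indicator (H j) x)"
    proof (cases "x \<in> E")
      case True
      then consider "x \<in> G" | j where "x \<in> H j" using E_sub by blast
      then show ?thesis
      proof cases
        case 1
        then show ?thesis using True by simp
      next
        case 2
        have "ennreal (u x) = ennreal (u x) * indicator (H j) x" using 2 by simp
        also have "\<dots> \<le> (\<Sum>j. ennreal (u x) * indicator (H j) x)"
          by (rule nth_le_suminf_ennreal)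
        finally show ?thesis using True by (simp add: add_increasing)
      qed
    qed simp
  qed
  also have "\<dots> = (\<integral>\<^sup>+x\<in>G. ennreal (u x) \<partial>lebesgue) + (\<Sum>j. \<integral>\<^sup>+x\<in>H j. ennreal (u x) \<partial>lebesgue)"
    by (subst nn_integral_add, measurable, subst nn_integral_suminf) auto
  also have "\<dots> \<le> 4 * V \<tau> + (\<Sum>j. \<kappa> j * V (t j))"
  proof (intro add_mono suminf_le H)
    show "(\<integral>\<^sup>+x\<in>G. ennreal (u x) \<partial>lebesgue) \<le> 4 * V \<tau>"
      unfolding G_def a_def V_def weighted_measure_def
      using \<Omega>[OF \<tau>] by (intro weak_top_bound[OF u \<delta> b(1)])
  qed auto
  finally show ?thesis unfolding V_def \<kappa>_def t_def .
qed

section \<open>Choice of the constants\<close>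

lemma powr_neg_bound:
  assumes \<delta>: "0 < \<delta>" and s: "1 \<le> s"
  shows "2 * (1/4) ^ s + (1 + real s * ln 2) powr (-\<delta>)
    \<le> (2 * \<delta> powr \<delta> + 2 powr \<delta>) * real s powr (-\<delta>)"
proof -
  have s0: "0 < real s" using s by simp
  have ln4: "1 \<le> ln (4 :: real)"
    using ln_le_cancel_iff[of "exp 1" "4 :: real"] exp_le by simp
  have "(1/4) ^ s \<le> \<delta> powr \<delta> * real s powr (-\<delta>)"
  proof -
    \<comment> \<open>From \<open>ln y \<le> y\<close> at \<open>y = s / \<delta>\<close> one gets
      \<open>exp (- s) \<le> \<delta> powr \<delta> * s powr (- \<delta>)\<close>, and
      \<open>(1/4) ^ s\<close> is no larger than \<open>exp (- s)\<close> since \<open>ln 4\<close>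
      is at least \<open>1\<close>.\<close>
    have "ln (real s / \<delta>) \<le> real s / \<delta>"
      using s0 \<delta> by (intro ln_bound) auto
    then have "\<delta> * ln (real s / \<delta>) \<le> real s"
      using \<delta> by (simp add: field_simps)
    then have "\<delta> * ln (real s) - \<delta> * ln \<delta> \<le> real s * 1"
      using s0 \<delta> by (simp add: ln_div algebra_simps)
    also have "real s * 1 \<le> real s * ln 4"
    proof (rule mult_left_mono)
      show "1 \<le> ln (4 :: real)" by (rule ln4)
    qed simp
    finally have "exp (- (real s * ln 4)) \<le> exp (\<delta> * ln \<delta> - \<delta> * ln (real s))" by simp
    moreover have "exp (- (real s * ln 4)) = (1/4 :: real) ^ s"
    proof -
      have "exp (- (real s * ln 4)) = exp (- ln 4 :: real) ^ s"
        by (simp add: exp_of_nat_mult[symmetric])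
      then show ?thesis by (simp add: exp_minus inverse_eq_divide)
    qed
    moreover have "exp (\<delta> * ln \<delta> - \<delta> * ln (real s)) = \<delta> powr \<delta> * real s powr (-\<delta>)"
      using \<delta> s0 by (simp add: powr_def exp_diff exp_minus divide_inverse)
    ultimately show ?thesis by simp
  qed
  moreover have "(1 + real s * ln 2) powr (-\<delta>) \<le> 2 powr \<delta> * real s powr (-\<delta>)"
  proof -
    have "1/2 \<le> ln (2 :: real)"
      using ln4 ln_realpow[of 2 2] by simp
    then have "real s * (1/2) \<le> real s * ln 2" by (intro mult_left_mono) auto
    then have "(1 + real s * ln 2) powr (-\<delta>) \<le> (real s / 2) powr (-\<delta>)"
      using s0 \<delta> by (intro powr_mono2') linarith+
    also have "\<dots> = 2 powr \<delta> * real s powr (-\<delta>)"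
      using s0 powr_divide[of "real s" 2 "-\<delta>"] powr_minus_divide[of 2 \<delta>] by simp
    finally show ?thesis .
  qed
  ultimately show ?thesis by (simp add: algebra_simps)
qed

text \<open>One height in the supremum, solved for the measure. The exponent
  \<open>1 / (1 / real m)\<close> is \<open>m\<close>, and the finite bound on the norm excludes
  infinite measure.\<close>

lemma weighted_measure_le_weak_norm:
  assumes m: "1 \<le> m" and t: "0 < t" and N: "weak_norm (1 / real m) v F \<le> ennreal N" "0 \<le> N"
  shows "weighted_measure v {x. ennreal t < F x} \<le> ennreal ((N / t) powr (1 / real m))"
proof -
  define X where "X = weighted_measure v {x. ennreal t < F x}"
  have "ennreal t * ennreal_powr X (1 / (1 / real m)) \<le> weak_norm (1 / real m) v F"
    unfolding weak_norm_def X_def using t by (intro SUP_upper) auto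
  then have le: "ennreal t * ennreal_powr X (real m) \<le> ennreal N"
    using N by (simp add: order_trans)
  have "X \<noteq> \<infinity>"
    using le t by (auto simp: ennreal_powr_def ennreal_mult_top top_unique)
  then obtain r where r: "X = ennreal r" "0 \<le> r" by (cases X) auto
  then have "ennreal (t * r powr real m) \<le> ennreal N"
    using le t by (simp add: ennreal_powr_def ennreal_mult)
  then have "r powr real m \<le> N / t"
    using t N by (simp add: field_simps)
  then have "(r powr real m) powr (1 / real m) \<le> (N / t) powr (1 / real m)"
    using m by (intro powr_mono2) auto
  then have "r \<le> (N / t) powr (1 / real m)"
    using m r by (simp add: powr_powr)
  then show ?thesis using r by (simp add: X_def[symmetric])
qed

lemma ennreal_powr_le:
  assumes "X \<le> ennreal y" "0 \<le> y" "0 \<le> p"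
  shows "ennreal_powr X p \<le> ennreal (y powr p)"
proof -
  obtain x where "X = ennreal x" "0 \<le> x"
    using assms by (cases X) (auto simp: top_unique)
  then show ?thesis
    using assms by (auto simp: ennreal_powr_def intro!: ennreal_leI powr_mono2)
qed

lemma ex_grid_base:
  assumes "0 < \<gamma>"
  obtains b :: nat where "2 \<le> b" "X \<le> real b powr \<gamma>"
proof
  let ?b = "max 2 (nat \<lceil>\<bar>X\<bar> powr (1 / \<gamma>)\<rceil>)"
  show "2 \<le> ?b" by simp
  have "\<bar>X\<bar> powr (1 / \<gamma>) \<le> real ?b" by linarith
  then have "(\<bar>X\<bar> powr (1 / \<gamma>)) powr \<gamma> \<le> real ?b powr \<gamma>"
    using assms by (intro powr_mono2) auto
  then show "X \<le> real ?b powr \<gamma>"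
    using assms by (simp add: powr_powr split: if_splits)
qed

text \<open>Both series are dominated by geometric ones. The first bounds the allowed contributions
  of the levels, the second the weights of the exceptional sets; its factor \<open>2 ^ Suc j\<close>
  accounts for the growth of the level sets when the height is halved \<open>Suc j\<close>
  times.\<close>

lemma ex_overlap_thresholds:
  assumes \<delta>: "0 < \<delta>"
  obtains s :: "nat \<Rightarrow> nat" and A B :: real where
    "\<And>j. 1 \<le> s j" "0 < A" "0 < B"
    "(\<Sum>j. ennreal ((1/2) ^ j * (2 * real (s j)))) \<le> ennreal A"
    "(\<Sum>j. ennreal (2 * (2 * (1/4) ^ s j + (1 + real (s j) * ln 2) powr (-\<delta>)) / real (s j) * 2 ^ Suc j))
      \<le> ennreal B"
proof -
  \<comment> \<open>The midpoint between \<open>1 / (1 + \<delta>)\<close> and \<open>1\<close>: the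
    upper bound makes the ratio \<open>r1\<close> less than \<open>1\<close>, the lower one the
    ratio \<open>r2\<close>.\<close>
  define \<sigma> where "\<sigma> = (1 + 1 / (1 + \<delta>)) / 2"
  have \<sigma>: "\<sigma> < 1" "1 < \<sigma> * (1 + \<delta>)"
    using \<delta> by (simp_all add: \<sigma>_def field_simps add_pos_pos)
  define s where "s j = nat \<lceil>2 powr (real j * \<sigma>)\<rceil>" for j
  define r1 where "r1 = (2::real) powr (\<sigma> - 1)"
  define r2 where "r2 = (2::real) powr (1 - \<sigma> * (1 + \<delta>))"
  define D where "D = 2 * (2 * \<delta> powr \<delta> + 2 powr \<delta>)"
  have r1: "0 < r1" "r1 < 1" and r2: "0 < r2" "r2 < 1"
    using \<sigma> powr_less_mono[of "\<sigma> - 1" 0 "2::real"] powr_less_mono[of "1 - \<sigma> * (1 + \<delta>)" 0 "2::real"]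
    by (simp_all add: r1_def r2_def)
  have D: "0 < D" using \<delta> by (simp add: D_def add_pos_pos)
  have \<sigma>0: "0 < \<sigma>" using \<delta> by (simp add: \<sigma>_def add_pos_pos)
  have ge1: "1 \<le> 2 powr (real j * \<sigma>)" for j
    using \<sigma>0 by (intro ge_one_powr_ge_zero) auto
  have s_ge: "2 powr (real j * \<sigma>) \<le> real (s j)" for j
    unfolding s_def by linarith
  \<comment> \<open>Rounding up costs at most a factor \<open>2\<close>, as the number rounded is at
    least \<open>1\<close>.\<close>
  have s_le: "real (s j) \<le> 2 * 2 powr (real j * \<sigma>)" for j
    using ge1[of j] unfolding s_def by linarith
  have s1: "1 \<le> s j" for j
    using ge1[of j] s_ge[of j] by simp
  have pow: "(2 powr e) ^ j = 2 powr (real j * e)" for e :: real and j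
    by (simp add: powr_powr powr_realpow[symmetric] mult.commute del: powr_realpow)
  have "(\<Sum>j. ennreal ((1/2) ^ j * (2 * real (s j)))) \<le> (\<Sum>j. ennreal (4 * r1 ^ j))"
  proof (intro suminf_le ennreal_leI)
    fix j
    have "(1/2 :: real) ^ j = 2 powr (- real j)"
      by (simp add: powr_minus powr_realpow power_one_over inverse_eq_divide)
    then have "(1/2) ^ j * (2 * real (s j)) \<le> 2 powr (- real j) * (2 * (2 * 2 powr (real j * \<sigma>)))"
      using s_le[of j] by (intro mult_mono) auto
    also have "\<dots> = 4 * r1 ^ j"
      unfolding r1_def pow by (simp add: powr_add[symmetric] algebra_simps)
    finally show "(1/2) ^ j * (2 * real (s j)) \<le> 4 * r1 ^ j" .
  qed auto
  also have "\<dots> = ennreal (4 * (1 / (1 - r1)))"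
    using r1 by (intro suminf_ennreal_eq sums_mult geometric_sums) auto
  finally have 1: "(\<Sum>j. ennreal ((1/2) ^ j * (2 * real (s j)))) \<le> ennreal (4 * (1 / (1 - r1)))" .
  have "(\<Sum>j. ennreal (2 * (2 * (1/4) ^ s j + (1 + real (s j) * ln 2) powr (-\<delta>)) / real (s j) * 2 ^ Suc j))
    \<le> (\<Sum>j. ennreal (2 * D * r2 ^ j))"
  proof (intro suminf_le ennreal_leI)
    fix j
    have sj: "0 < real (s j)" using s1[of j] by simp
    have "2 * (2 * (1/4) ^ s j + (1 + real (s j) * ln 2) powr (-\<delta>)) / real (s j)
      \<le> D * real (s j) powr (-\<delta>) / real (s j)"
    proof (rule divide_right_mono)
      show "2 * (2 * (1/4) ^ s j + (1 + real (s j) * ln 2) powr (-\<delta>)) \<le> D * real (s j) powr (-\<delta>)"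
        unfolding D_def mult.assoc by (rule mult_left_mono[OF powr_neg_bound[OF \<delta> s1]]) simp
    qed simp
    also have "\<dots> = D * real (s j) powr (- \<delta> - 1)"
      using sj powr_diff[of "real (s j)" "-\<delta>" 1] by simp
    also have "\<dots> \<le> D * (2 powr (real j * \<sigma>)) powr (- \<delta> - 1)"
      using s_ge[of j] D \<delta> by (intro mult_left_mono powr_mono2') auto
    finally have "2 * (2 * (1/4) ^ s j + (1 + real (s j) * ln 2) powr (-\<delta>)) / real (s j) * 2 ^ Suc j
      \<le> D * (2 powr (real j * \<sigma>)) powr (- \<delta> - 1) * 2 ^ Suc j"
      by (rule mult_right_mono) simp
    also have "\<dots> = 2 * D * (2 powr (real j * \<sigma> * (- \<delta> - 1)) * 2 powr (real j))"
      by (simp add: powr_powr powr_realpow)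
    also have "\<dots> = 2 * D * r2 ^ j"
      unfolding r2_def pow powr_add[symmetric] by (simp add: algebra_simps)
    finally show "2 * (2 * (1/4) ^ s j + (1 + real (s j) * ln 2) powr (-\<delta>)) / real (s j) * 2 ^ Suc j
      \<le> 2 * D * r2 ^ j" .
  qed auto
  also have "\<dots> = ennreal (2 * D * (1 / (1 - r2)))"
    using r2 D by (intro suminf_ennreal_eq sums_mult geometric_sums) auto
  finally have 2: "(\<Sum>j. ennreal (2 * (2 * (1/4) ^ s j + (1 + real (s j) * ln 2) powr (-\<delta>)) / real (s j) * 2 ^ Suc j))
    \<le> ennreal (2 * D * (1 / (1 - r2)))" .
  show thesis
    by (rule that[OF s1 _ _ 1 2]) (use r1 r2 D in auto)
qed

section \<open>Combination of the estimates\<close>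

theorem theorem2p23:
  fixes \<alpha> \<delta> :: real and m :: nat
  assumes "1 \<le> m" and "0 < \<alpha>" and "\<alpha> < real CARD('n::finite) * real m" and "0 < \<delta>"
  shows "\<exists>C>0. \<forall>(u :: real^'n \<Rightarrow> real) (f :: nat \<Rightarrow> real^'n \<Rightarrow> complex).
           weight u \<longrightarrow>
           (\<forall>i<m. f i \<in> borel_measurable lebesgue) \<longrightarrow>
           frac_integral_converges \<alpha> m f \<longrightarrow>
           weak_norm (1 / real m) (\<lambda>x. ennreal (u x)) (\<lambda>x. ennreal (norm (frac_integral \<alpha> m f x)))
             \<le> ennreal C *
               weak_norm (1 / real m) (orlicz_maximal (LlogL \<delta>) u) (frac_maximal \<alpha> m f)"
proof -
  note m = assms(1) and \<alpha> = assms(2) and \<delta> = assms(4)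
  have \<alpha>': "\<alpha> < real m * real CARD('n)" using assms(3) by (simp add: mult.commute)
  have "0 < \<alpha> / real m" using m \<alpha> by simp
  then obtain b :: nat where b: "2 \<le> b" "16 * real m * 3 ^ CARD('n) \<le> real b powr (\<alpha> / real m)"
    using ex_grid_base by metis
  have b0: "0 < b" using b by simp
  obtain s :: "nat \<Rightarrow> nat" and A B :: real where s: "\<And>j. 1 \<le> s j" and AB: "0 < A" "0 < B" and
    A: "(\<Sum>j. ennreal ((1/2) ^ j * (2 * real (s j)))) \<le> ennreal A" and
    B: "(\<Sum>j. ennreal (2 * (2 * (1/4) ^ s j + (1 + real (s j) * ln 2) powr (-\<delta>)) / real (s j) * 2 ^ Suc j))
      \<le> ennreal B"
    by (rule ex_overlap_thresholds[OF \<delta>]) (rule that)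
  define C0 where "C0 = real b powr (real m * real CARD('n) - \<alpha>)"
  \<comment> \<open>Chosen so that for \<open>\<tau> = c * T\<close> the allowed contributions,
    which add up to at most \<open>\<tau> * A\<close>, do not exceed \<open>T\<close> after
    multiplication by \<open>C0\<close>.\<close>
  define c where "c = 1 / (C0 * A)"
  define c3 where "c3 = (3::real) powr (\<alpha> - real m * real CARD('n))"
  define L where "L = 4 + B"
  have C0: "0 < C0" using b0 by (simp add: C0_def)
  have c: "0 < c" using C0 AB by (simp add: c_def)
  have c3: "0 < c3" by (simp add: c3_def)
  have L: "0 < L" using AB by (simp add: L_def)
  \<comment> \<open>The solution of \<open>T * (w * L) powr real m = C * N\<close>, where
    \<open>w * L\<close> will bound the weight of the level set at height \<open>T\<close>.\<close>
  define C where "C = L powr real m / (c3 * c)"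
  have C: "0 < C" using L c c3 by (simp add: C_def)
  have main: "weak_norm (1 / real m) (\<lambda>x. ennreal (u x)) (\<lambda>x. ennreal (norm (frac_integral \<alpha> m f x)))
      \<le> ennreal C * weak_norm (1 / real m) (orlicz_maximal (LlogL \<delta>) u) (frac_maximal \<alpha> m f)"
    if u: "weight u" and f: "\<forall>i<m. f i \<in> borel_measurable lebesgue"
    for u :: "real^'n \<Rightarrow> real" and f :: "nat \<Rightarrow> real^'n \<Rightarrow> complex"
  proof (cases "weak_norm (1 / real m) (orlicz_maximal (LlogL \<delta>) u) (frac_maximal \<alpha> m f)")
    \<comment> \<open>The right side is infinite, as \<open>C\<close> is positive.\<close>
    case top
    then show ?thesis using C by (simp add: ennreal_mult_top)
  next
    case (real N)
    define g where "g l y = ennreal (norm (f l y))" for l y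
    have g: "g l \<in> borel_measurable lebesgue" if "l < m" for l
    proof -
      have [measurable]: "f l \<in> borel_measurable lebesgue" using f that by simp
      show ?thesis unfolding g_def by measurable
    qed
    define \<Omega> where "\<Omega> t = {x. ennreal (c3 * t) < frac_maximal \<alpha> m f x}" for t
    show ?thesis
      unfolding weak_norm_def[of _ "\<lambda>x. ennreal (u x)"]
    proof (rule SUP_least)
      fix T :: real assume "T \<in> {t. 0 < t}"
      then have T: "0 < T" by simp
      define \<tau> where "\<tau> = c * T"
      have \<tau>: "0 < \<tau>" using c T by (simp add: \<tau>_def)
      \<comment> \<open>The bound that the norm \<open>N\<close> gives for the measure of the level
        set of the maximal function at height \<open>c3 * \<tau>\<close>.\<close>
      define w where "w = (N / (c3 * \<tau>)) powr (1 / real m)"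
      have w: "0 \<le> w" by (simp add: w_def)
      define E where "E = {x. ennreal T < ennreal (norm (frac_integral \<alpha> m f x))}"
      have V: "weighted_measure (orlicz_maximal (LlogL \<delta>) u) (\<Omega> t) \<le> ennreal ((N / (c3 * t)) powr (1 / real m))"
        if "0 < t" for t
        unfolding \<Omega>_def using real that c3 by (intro weighted_measure_le_weak_norm[OF m]) auto
      \<comment> \<open>Halving the height multiplies the bound by
        \<open>2 powr (1 / real m)\<close>, which is at most \<open>2\<close> because
        \<open>m\<close> is at least \<open>1\<close>.\<close>
      have Vj: "weighted_measure (orlicz_maximal (LlogL \<delta>) u) (\<Omega> (\<tau> * (1/2) ^ Suc j)) \<le> ennreal (w * 2 ^ Suc j)" for j
      proof -
        have "(N / (c3 * (\<tau> * (1/2) ^ Suc j))) powr (1 / real m) =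
            w * ((2 :: real) ^ Suc j) powr (1 / real m)"
        proof -
          have "N / (c3 * (\<tau> * (1/2) ^ Suc j)) = N / (c3 * \<tau>) * 2 ^ Suc j"
            by (simp add: power_one_over)
          then show ?thesis
            unfolding w_def by (simp only: powr_mult)
        qed
        also have "\<dots> \<le> w * (2 ^ Suc j) powr 1"
          using w m by (intro mult_left_mono powr_mono one_le_power) auto
        finally have "(N / (c3 * (\<tau> * (1/2) ^ Suc j))) powr (1 / real m) \<le> w * 2 ^ Suc j"
          by simp
        then show ?thesis
          using V[of "\<tau> * (1/2) ^ Suc j"] \<tau> by (intro order_trans[OF V ennreal_leI]) auto
      qed
      have "weighted_measure (\<lambda>x. ennreal (u x)) E \<le>
        4 * weighted_measure (orlicz_maximal (LlogL \<delta>) u) (\<Omega> \<tau>) +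
        (\<Sum>j. ennreal (2 * (2 * (1/4) ^ s j + (1 + real (s j) * ln 2) powr (-\<delta>)) / real (s j)) *
          weighted_measure (orlicz_maximal (LlogL \<delta>) u) (\<Omega> (\<tau> * (1/2) ^ Suc j)))"
      proof (rule weighted_measure_grid_sum_gt[OF u \<delta> m \<alpha> \<tau> b0 b(2) g s])
        fix t k x assume t: "0 < t" "ennreal t < grid_frac b \<alpha> m g k (grid_index b k x)"
        have "ennreal (c3 * t) < ennreal c3 * grid_frac b \<alpha> m g k (grid_index b k x)"
          using t c3 by (cases "grid_frac b \<alpha> m g k (grid_index b k x)")
            (auto simp: ennreal_mult[symmetric] ennreal_less_iff ennreal_mult_top)
        also have "\<dots> \<le> frac_maximal \<alpha> m f x"
          unfolding c3_def g_def by (rule grid_frac_le_frac_maximal[OF b0])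
        finally show "x \<in> \<Omega> t" by (simp add: \<Omega>_def)
      next
        fix x assume x: "x \<in> E"
        define S where "S = (\<integral>\<^sup>+k. grid_frac b \<alpha> m g k (grid_index b k x) \<partial>count_space UNIV)"
        have "ennreal T < ennreal C0 * S"
          using x norm_frac_integral_le[OF b(1) \<alpha>', of f x] f
          unfolding E_def C0_def S_def g_def by (auto intro: less_le_trans)
        moreover have "ennreal C0 * S \<le> ennreal T" if "S \<le> ennreal (\<tau> * A)"
        proof -
          have "ennreal C0 * S \<le> ennreal C0 * ennreal (\<tau> * A)"
            using that by (rule mult_left_mono) simp
          also have "\<dots> = ennreal T"
            using C0 AB T by (simp add: ennreal_mult[symmetric] \<tau>_def c_def)
          finally show ?thesis .
        qed
        ultimately have "ennreal (\<tau> * A) < S" by (meson linorder_not_le)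
        moreover have "(\<Sum>j. ennreal (\<tau> * (1/2) ^ j * (2 * real (s j)))) \<le> ennreal (\<tau> * A)"
        proof -
          have "(\<Sum>j. ennreal (\<tau> * (1/2) ^ j * (2 * real (s j)))) =
              ennreal \<tau> * (\<Sum>j. ennreal ((1/2) ^ j * (2 * real (s j))))"
            using \<tau> by (subst ennreal_suminf_cmult[symmetric]) (simp add: ennreal_mult[symmetric] mult.assoc)
          also have "\<dots> \<le> ennreal \<tau> * ennreal A"
            by (intro mult_left_mono A) simp
          also have "\<dots> = ennreal (\<tau> * A)" using \<tau> AB by (simp add: ennreal_mult)
          finally show ?thesis .
        qed
        ultimately show "(\<Sum>j. ennreal (\<tau> * (1/2) ^ j * (2 * real (s j))))
            < (\<integral>\<^sup>+k. grid_frac b \<alpha> m g k (grid_index b k x) \<partial>count_space UNIV)"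
          unfolding S_def by (rule le_less_trans[rotated])
      qed
      also have "\<dots> \<le> 4 * ennreal w +
        (\<Sum>j. ennreal (2 * (2 * (1/4) ^ s j + (1 + real (s j) * ln 2) powr (-\<delta>)) / real (s j)) *
          ennreal (w * 2 ^ Suc j))"
        using V[OF \<tau>] Vj by (intro add_mono mult_left_mono suminf_le) (auto simp: w_def)
      also have "(\<Sum>j. ennreal (2 * (2 * (1/4) ^ s j + (1 + real (s j) * ln 2) powr (-\<delta>)) / real (s j)) *
          ennreal (w * 2 ^ Suc j)) =
          ennreal w * (\<Sum>j. ennreal (2 * (2 * (1/4) ^ s j + (1 + real (s j) * ln 2) powr (-\<delta>)) / real (s j) * 2 ^ Suc j))"
        unfolding ennreal_suminf_cmult[symmetric] ennreal_mult'[OF w] using w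
        by (subst ennreal_mult) (auto simp: mult_ac)
      also have "4 * ennreal w + \<dots> \<le> 4 * ennreal w + ennreal w * ennreal B"
        by (intro add_left_mono mult_left_mono B) simp
      also have "\<dots> = ennreal (w * L)"
        using w AB by (simp add: L_def distrib_left ennreal_plus ennreal_mult mult.commute)
      finally have uE: "weighted_measure (\<lambda>x. ennreal (u x)) E \<le> ennreal (w * L)" .
      have "ennreal T * ennreal_powr (weighted_measure (\<lambda>x. ennreal (u x)) E) (1 / (1 / real m))
          \<le> ennreal T * ennreal ((w * L) powr real m)"
        using uE w L by (intro mult_left_mono) (auto intro!: ennreal_powr_le)
      also have "\<dots> = ennreal (T * (w * L) powr real m)"
        using T by (simp add: ennreal_mult)
      also have "T * (w * L) powr real m = C * N"
      proof -
        have "w powr real m = N / (c3 * \<tau>)"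
          using m real c3 \<tau> by (simp add: w_def powr_powr)
        then have "(w * L) powr real m = N / (c3 * \<tau>) * L powr real m"
          using w L by (simp add: powr_mult)
        then show ?thesis
          using T c c3 by (simp add: C_def \<tau>_def)
      qed
      also have "ennreal (C * N) = ennreal C * weak_norm (1 / real m) (orlicz_maximal (LlogL \<delta>) u) (frac_maximal \<alpha> m f)"
        using C real by (simp add: ennreal_mult)
      finally show "ennreal T * ennreal_powr (weighted_measure (\<lambda>x. ennreal (u x))
            {x. ennreal T < ennreal (norm (frac_integral \<alpha> m f x))}) (1 / (1 / real m))
          \<le> ennreal C * weak_norm (1 / real m) (orlicz_maximal (LlogL \<delta>) u) (frac_maximal \<alpha> m f)"
        by (simp add: E_def)
    qed
  qed
  show ?thesis using C main by blast
qed

end
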